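(* Let $\phi$ be a sign-normalized rank-two Drinfeld $\mathbf A$-module over $L$ with attached data $V=(\alpha,\beta)$, $m$, $h$, $\kappa$, and let $C_2\tau^2\mathbf s_\phi=C_1\tau\mathbf s_\phi+C_0\mathbf s_\phi$ be its normalized motive relation. Then: (1) $C_2=x^2-\chi_1x+\chi_2$; (2) $C_1=\lambda_2C_2+\lambda_1C_1'$ for some constants $\lambda_1,\lambda_2\in L$, where $C_1'=hC_2=y+(\kappa+a_1)(x-\alpha)-\beta$; (3) $C_0=(x+\gamma_1)C_1'+\gamma_2C_2$. Here $$\gamma_1=(\kappa^q+m+a_1)(m-\kappa)-\theta,\quad \gamma_2=-\kappa^q-m-a_1,\quad \chi_1=\kappa^2+a_1\kappa-a_2-\alpha,$$ $$\chi_2=a_4-2\kappa\beta^\vee+\kappa^2\alpha-a_1\beta^\vee-a_3\kappa+a_2\alpha+\alpha^2 .$$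
   Context: Let $q$ be a prime power and $E: y^2+a_1xy+a_3y=x^3+a_2x^2+a_4x+a_6$ ($a_i\in\mathbb F_q$) an elliptic curve with point at infinity $\infty$; $\mathbf A=\mathbb F_q[x,y]$. Let $\mathbb K=\mathbb F_q(\theta,\eta)$ be an isomorphic copy of $\mathbb F_q(x,y)$ via $x\mapsto\theta,\ y\mapsto\eta$; $L\supseteq\mathbb K$ algebraically closed; $\xi=(\theta,\eta)\in E(L)$; $\mathbf A_L=L\otimes\mathbf A$; $\mathbf K_L$ its fraction field. $\dotplus$ is the group law, $P^\vee$ the inverse of $P$ (so $(a,b)^\vee=(a,b^\vee)$, $b^\vee=-b-a_1a-a_3$), $(a,b)^{(1)}=(a^q,b^q)$. For $g\in\mathbf K_L$, $g^{(1)}$ is obtained by raising coefficients in $L$ to the $q$-th power and fixing $x,y$. $D^{-1}\mathbf A_L=\bigcup_{k\ge0}\mathcal L(D+k\infty)$. $L\{\tau\}$: twisted polynomials, $\tau c=c^q\tau$. A sign-normalized rank-two Drinfeld $\mathbf A$-module over $L$ is an $\mathbb F_q$-algebra homomorphism $\phi:\mathbf A\to L\{\tau\}$ with $\phi_x=\theta+g_1\tau+g_2\tau^2+g_3\tau^3+\tau^4$, $\phi_y=\eta+h_1\tau+\dots+h_5\tau^5+\tau^6$. Its Anderson motive is $M_\phi=L\{\tau\}\cdot\mathbf s_\phi$ (free of rank one over $L\{\tau\}$), with $a\cdot(\omega\mathbf s_\phi)=\omega\phi_a\mathbf s_\phi$ and $\tau(gm)=g^{(1)}\tau m$. Attached data: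 $V=(\alpha,\beta)\in E(L)$ satisfies $V\dotplus(V^{(1)})^\vee=\xi$; $m=\frac{\beta^q-\beta^\vee}{\alpha^q-\alpha}$ is the slope of the line through $\xi,V^{(1)},V^\vee$; $f_\alpha=\frac{y-\eta-m(x-\theta)}{x-\alpha}$; and $\wedge^2_{\mathbf A_L}M_\phi=V^{-1}\mathbf A_L\cdot S_0$ with $\tau S_0=-f_\alpha S_0$. Write $S_0=h\,\mathbf s_\phi\wedge\tau\mathbf s_\phi$, with $S_0$ (unique up to $\mathbb F_q^\times$) chosen so that $h$ has sign $1$ (leading coefficient at $\infty$, with $x,y$ of sign $1$). Then $(h)=V+\infty-\dot V-\ddot V$ with $\dot V\dotplus\ddot V=V$, and $\kappa$ is the slope of the line through $V^\vee,\dot V,\ddot V$. Normalized motive relation: the relation $C_2\tau^2\mathbf s_\phi=C_1\tau\mathbf s_\phi+C_0\mathbf s_\phi$ with $C_2\in\langle x^2,x,1\rangle_L$, $C_1\in\langle x^2,y,x,1\rangle_L$, $C_0\in\langle xy,x^2,y,x,1\rangle_L$ ($L$-spans), where the coefficient of $x^2$ in $C_2$ and that of $xy$ in $C_0$ are $1$.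
   Formalization: The normalized motive relation is not unique for some φ (e.g. restrictions of rank-one modules over F_{q²}[x,y]); it is shown that every φ has a normalized relation satisfying (1)–(3), and that the normalized relation satisfies them whenever it is unique. *)

theory Defs
  imports "HOL-Computational_Algebra.Computational_Algebra" "HOL-Library.Poly_Mapping"
begin

section \<open>The curve, its coordinate ring and its function field\<close>

text \<open>
  A Weierstrass equation \<open>y^2 + a1 x y + a3 y = x^3 + a2 x^2 + a4 x + a6\<close> over the field \<open>'l\<close>,
  together with a field \<open>'f\<close>, a map \<open>emb\<close> from \<open>'l\<close> to \<open>'f\<close> and two elements \<open>xf\<close>, \<open>yf\<close> of \<open>'f\<close>.
  The predicate \<open>function_field\<close> below says that \<open>'f\<close> is the fraction field of
  \<open>'l[x,y]/(Weierstrass equation)\<close>, with \<open>emb\<close> the inclusion of the constants and \<open>xf\<close>, \<open>yf\<close>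
  the classes of \<open>x\<close>, \<open>y\<close>.
\<close>

record ('l, 'f) curve =
  a\<^sub>1 :: 'l
  a\<^sub>2 :: 'l
  a\<^sub>3 :: 'l
  a\<^sub>4 :: 'l
  a\<^sub>6 :: 'l
  emb :: "'l \<Rightarrow> 'f"
  xf :: 'f
  yf :: 'f

definition discriminant :: "('l::field, 'f) curve \<Rightarrow> 'l" where
  "discriminant E =
    (let b2 = a\<^sub>1 E ^ 2 + 4 * a\<^sub>2 E;
         b4 = 2 * a\<^sub>4 E + a\<^sub>1 E * a\<^sub>3 E;
         b6 = a\<^sub>3 E ^ 2 + 4 * a\<^sub>6 E;
         b8 = a\<^sub>1 E ^ 2 * a\<^sub>6 E + 4 * a\<^sub>2 E * a\<^sub>6 E - a\<^sub>1 E * a\<^sub>3 E * a\<^sub>4 E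
              + a\<^sub>2 E * a\<^sub>3 E ^ 2 - a\<^sub>4 E ^ 2
     in - (b2 ^ 2 * b8) - 8 * b4 ^ 3 - 27 * b6 ^ 2 + 9 * b2 * b4 * b6)"

text \<open>The subfield with \<open>q\<close> elements of an algebraically closed field whose characteristic divides \<open>q\<close>.\<close>

definition Fq :: "nat \<Rightarrow> 'l::field set" where
  "Fq q = {c. c ^ q = c}"

definition elliptic_over_Fq :: "nat \<Rightarrow> ('l::field, 'f) curve \<Rightarrow> bool" where
  "elliptic_over_Fq q E \<longleftrightarrow>
     {a\<^sub>1 E, a\<^sub>2 E, a\<^sub>3 E, a\<^sub>4 E, a\<^sub>6 E} \<subseteq> Fq q \<and> discriminant E \<noteq> 0"

text \<open>\<open>elt E u v\<close> is \<open>u(x) + v(x) y\<close>.  These elements form \<open>A_L\<close>; those with coefficients in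
  \<open>Fq\<close> form the coordinate ring \<open>A\<close> over \<open>Fq\<close>.\<close>

definition elt :: "('l::field, 'f::field) curve \<Rightarrow> 'l poly \<Rightarrow> 'l poly \<Rightarrow> 'f" where
  "elt E u v = poly (map_poly (emb E) u) (xf E) + poly (map_poly (emb E) v) (xf E) * yf E"

definition coord_ring_L :: "('l::field, 'f::field) curve \<Rightarrow> 'f set" where
  "coord_ring_L E = {elt E u v | u v. True}"

definition coord_ring :: "nat \<Rightarrow> ('l::field, 'f::field) curve \<Rightarrow> 'f set" where
  "coord_ring q E =
     {elt E u v | u v. (\<forall>i. poly.coeff u i \<in> Fq q) \<and> (\<forall>i. poly.coeff v i \<in> Fq q)}"

definition function_field :: "('l::field, 'f::field) curve \<Rightarrow> bool" where
  "function_field E \<longleftrightarrow>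
     emb E 1 = 1 \<and>
     (\<forall>c d. emb E (c + d) = emb E c + emb E d) \<and>
     (\<forall>c d. emb E (c * d) = emb E c * emb E d) \<and>
     yf E ^ 2 + emb E (a\<^sub>1 E) * xf E * yf E + emb E (a\<^sub>3 E) * yf E
       = xf E ^ 3 + emb E (a\<^sub>2 E) * xf E ^ 2 + emb E (a\<^sub>4 E) * xf E + emb E (a\<^sub>6 E) \<and>
     (\<forall>u v. elt E u v = 0 \<longrightarrow> u = 0 \<and> v = 0) \<and>
     (\<forall>g. \<exists>a\<in>coord_ring_L E. \<exists>b\<in>coord_ring_L E. b \<noteq> 0 \<and> g = a / b)"

text \<open>The unique \<open>(u, v)\<close> with \<open>g = u(x) + v(x) y\<close>, for \<open>g\<close> in \<open>A_L\<close>.\<close>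

definition coords :: "('l::field, 'f::field) curve \<Rightarrow> 'f \<Rightarrow> 'l poly \<times> 'l poly" where
  "coords E g = (THE uv. g = elt E (fst uv) (snd uv))"

text \<open>\<open>g\<close> is sent to \<open>g^(1)\<close>: coefficients are raised to the \<open>q\<close>-th power, \<open>x\<close> and \<open>y\<close> are fixed.\<close>

definition twist_ring :: "nat \<Rightarrow> ('l::field, 'f::field) curve \<Rightarrow> 'f \<Rightarrow> 'f" where
  "twist_ring q E g = (case coords E g of (u, v) \<Rightarrow>
     elt E (map_poly (\<lambda>c. c ^ q) u) (map_poly (\<lambda>c. c ^ q) v))"

definition twist :: "nat \<Rightarrow> ('l::field, 'f::field) curve \<Rightarrow> 'f \<Rightarrow> 'f" where
  "twist q E g = (THE z. \<exists>a\<in>coord_ring_L E. \<exists>b\<in>coord_ring_L E.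
     b \<noteq> 0 \<and> g = a / b \<and> z = twist_ring q E a / twist_ring q E b)"

section \<open>Points and the group law\<close>

datatype 'l point = Infinity | Affine 'l 'l

fun on_curve :: "('l::field, 'f) curve \<Rightarrow> 'l point \<Rightarrow> bool" where
  "on_curve E Infinity = True"
| "on_curve E (Affine a b) =
     (b ^ 2 + a\<^sub>1 E * a * b + a\<^sub>3 E * b = a ^ 3 + a\<^sub>2 E * a ^ 2 + a\<^sub>4 E * a + a\<^sub>6 E)"

fun neg_pt :: "('l::field, 'f) curve \<Rightarrow> 'l point \<Rightarrow> 'l point" where
  "neg_pt E Infinity = Infinity"
| "neg_pt E (Affine a b) = Affine a (- b - a\<^sub>1 E * a - a\<^sub>3 E)"

text \<open>The chord and tangent law for general Weierstrass equations: \<open>s\<close> is the slope of the chord,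
  respectively the tangent.\<close>

fun add_pt :: "('l::field, 'f) curve \<Rightarrow> 'l point \<Rightarrow> 'l point \<Rightarrow> 'l point" where
  "add_pt E Infinity Q = Q"
| "add_pt E P Infinity = P"
| "add_pt E (Affine x1 y1) (Affine x2 y2) =
    (if x1 = x2 \<and> y1 + y2 + a\<^sub>1 E * x2 + a\<^sub>3 E = 0 then Infinity
     else
       let s = (if x1 = x2
                then (3 * x1 ^ 2 + 2 * a\<^sub>2 E * x1 + a\<^sub>4 E - a\<^sub>1 E * y1)
                       / (2 * y1 + a\<^sub>1 E * x1 + a\<^sub>3 E)
                else (y2 - y1) / (x2 - x1));
           x3 = s ^ 2 + a\<^sub>1 E * s - a\<^sub>2 E - x1 - x2;
           y3 = - (s + a\<^sub>1 E) * x3 - (y1 - s * x1) - a\<^sub>3 E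
       in Affine x3 y3)"

fun frob_pt :: "nat \<Rightarrow> 'l::field point \<Rightarrow> 'l point" where
  "frob_pt q Infinity = Infinity"
| "frob_pt q (Affine a b) = Affine (a ^ q) (b ^ q)"

text \<open>\<open>Fq(\<theta>,\<eta>)\<close> is a copy of \<open>Fq(x,y)\<close> via \<open>x \<mapsto> \<theta>\<close>, \<open>y \<mapsto> \<eta>\<close>: the point lies on the curve and
  evaluation at it is injective on \<open>Fq[x,y]\<close>.\<close>

definition generic_point :: "nat \<Rightarrow> ('l::field, 'f) curve \<Rightarrow> 'l \<Rightarrow> 'l \<Rightarrow> bool" where
  "generic_point q E \<theta> \<eta> \<longleftrightarrow>
     on_curve E (Affine \<theta> \<eta>) \<and>
     (\<forall>u v. (\<forall>i. poly.coeff u i \<in> Fq q) \<and> (\<forall>i. poly.coeff v i \<in> Fq q) \<and>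
        poly u \<theta> + poly v \<theta> * \<eta> = 0 \<longrightarrow> u = 0 \<and> v = 0)"

section \<open>Orders, signs and divisors of functions\<close>

text \<open>The pole order at infinity and the leading coefficient (sign) of a nonzero element of \<open>A_L\<close>:
  \<open>x\<close> and \<open>y\<close> have pole orders 2 and 3 and sign 1.  The orders of \<open>u(x)\<close> and \<open>v(x) y\<close> never agree.\<close>

definition pole_deg :: "('l::field, 'f::field) curve \<Rightarrow> 'f \<Rightarrow> nat" where
  "pole_deg E g = (case coords E g of (u, v) \<Rightarrow>
     if v = 0 then 2 * Polynomial.degree u
     else max (2 * Polynomial.degree u) (2 * Polynomial.degree v + 3))"

definition sign_ring :: "('l::field, 'f::field) curve \<Rightarrow> 'f \<Rightarrow> 'l" where
  "sign_ring E g = (case coords E g of (u, v) \<Rightarrow>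
     if v = 0 \<or> 2 * Polynomial.degree u > 2 * Polynomial.degree v + 3
     then lead_coeff u else lead_coeff v)"

definition sign :: "('l::field, 'f::field) curve \<Rightarrow> 'f \<Rightarrow> 'l" where
  "sign E g = (THE c. \<exists>a\<in>coord_ring_L E. \<exists>b\<in>coord_ring_L E.
     a \<noteq> 0 \<and> b \<noteq> 0 \<and> g = a / b \<and> c = sign_ring E a / sign_ring E b)"

definition eval_at :: "('l::field, 'f::field) curve \<Rightarrow> 'l \<Rightarrow> 'l \<Rightarrow> 'f \<Rightarrow> 'l" where
  "eval_at E a b g = (case coords E g of (u, v) \<Rightarrow> poly u a + poly v a * b)"

text \<open>The local ring of functions regular at a point, and its maximal ideal.\<close>

fun local_ring :: "('l::field, 'f::field) curve \<Rightarrow> 'l point \<Rightarrow> 'f set" where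
  "local_ring E (Affine a b) =
     {f / g | f g. f \<in> coord_ring_L E \<and> g \<in> coord_ring_L E \<and> eval_at E a b g \<noteq> 0}"
| "local_ring E Infinity =
     {f / g | f g. f \<in> coord_ring_L E \<and> g \<in> coord_ring_L E \<and> g \<noteq> 0 \<and>
        (f = 0 \<or> pole_deg E f \<le> pole_deg E g)}"

fun max_ideal :: "('l::field, 'f::field) curve \<Rightarrow> 'l point \<Rightarrow> 'f set" where
  "max_ideal E (Affine a b) =
     {f / g | f g. f \<in> coord_ring_L E \<and> g \<in> coord_ring_L E \<and> eval_at E a b g \<noteq> 0 \<and>
        eval_at E a b f = 0}"
| "max_ideal E Infinity =
     {f / g | f g. f \<in> coord_ring_L E \<and> g \<in> coord_ring_L E \<and> g \<noteq> 0 \<and>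
        (f = 0 \<or> pole_deg E f < pole_deg E g)}"

definition uniformizer :: "('l::field, 'f::field) curve \<Rightarrow> 'l point \<Rightarrow> 'f \<Rightarrow> bool" where
  "uniformizer E P t \<longleftrightarrow>
     t \<in> max_ideal E P \<and> (\<forall>g\<in>max_ideal E P. \<exists>r\<in>local_ring E P. g = r * t)"

definition ord_at :: "('l::field, 'f::field) curve \<Rightarrow> 'l point \<Rightarrow> 'f \<Rightarrow> int" where
  "ord_at E P g = (THE n. \<exists>t r. uniformizer E P t \<and> r \<in> local_ring E P - max_ideal E P \<and>
     g = t powi n * r)"

type_synonym 'l divisor = "'l point \<Rightarrow>\<^sub>0 int"

abbreviation pt :: "'l point \<Rightarrow> 'l divisor" where
  "pt P \<equiv> Poly_Mapping.single P 1"

definition has_divisor :: "('l::field, 'f::field) curve \<Rightarrow> 'f \<Rightarrow> 'l divisor \<Rightarrow> bool" where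
  "has_divisor E g D \<longleftrightarrow>
     g \<noteq> 0 \<and> (\<forall>P. on_curve E P \<longrightarrow> ord_at E P g = Poly_Mapping.lookup D P)"

definition riemann_roch_space :: "('l::field, 'f::field) curve \<Rightarrow> 'l divisor \<Rightarrow> 'f set" where
  "riemann_roch_space E D =
     {g. g = 0 \<or> (\<forall>P. on_curve E P \<longrightarrow> ord_at E P g + Poly_Mapping.lookup D P \<ge> 0)}"

text \<open>The fractional ideal \<open>D^-1 A_L\<close>.\<close>

definition inv_ideal :: "('l::field, 'f::field) curve \<Rightarrow> 'l divisor \<Rightarrow> 'f set" where
  "inv_ideal E D = (\<Union>k::nat. riemann_roch_space E (D + Poly_Mapping.single Infinity (int k)))"

text \<open>Some line \<open>y = s x + c\<close> meets the curve exactly in \<open>P\<close>, \<open>Q\<close>, \<open>R\<close>, counted with multiplicity.\<close>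

definition line_slope ::
    "('l::field, 'f::field) curve \<Rightarrow> 'l point \<Rightarrow> 'l point \<Rightarrow> 'l point \<Rightarrow> 'l \<Rightarrow> bool" where
  "line_slope E P Q R s \<longleftrightarrow>
     (\<exists>c. has_divisor E (yf E - emb E s * xf E - emb E c)
            (pt P + pt Q + pt R - Poly_Mapping.single Infinity 3))"

section \<open>Drinfeld modules and their motives\<close>

text \<open>Multiplication of twisted polynomials, \<open>\<tau> c = c^q \<tau>\<close>.  The polynomial with coefficients \<open>c_i\<close>
  represents \<open>\<Sum> c_i \<tau>^i\<close>; the ordinary product of \<open>'l poly\<close> plays no role for them.\<close>

definition tmul :: "nat \<Rightarrow> 'l::field poly \<Rightarrow> 'l poly \<Rightarrow> 'l poly" where
  "tmul q f g = (\<Sum>i\<le>Polynomial.degree f. \<Sum>j\<le>Polynomial.degree g.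
     Polynomial.monom (poly.coeff f i * poly.coeff g j ^ (q ^ i)) (i + j))"

definition sgn_drinfeld_rank2 ::
    "nat \<Rightarrow> ('l::field, 'f::field) curve \<Rightarrow> 'l \<Rightarrow> 'l \<Rightarrow> ('f \<Rightarrow> 'l poly) \<Rightarrow> bool" where
  "sgn_drinfeld_rank2 q E \<theta> \<eta> \<phi> \<longleftrightarrow>
     (\<forall>a\<in>coord_ring q E. \<forall>b\<in>coord_ring q E.
        \<phi> (a + b) = \<phi> a + \<phi> b \<and> \<phi> (a * b) = tmul q (\<phi> a) (\<phi> b)) \<and>
     (\<forall>c\<in>Fq q. \<phi> (emb E c) = [:c:]) \<and>
     (\<exists>g1 g2 g3. \<phi> (xf E) = [:\<theta>, g1, g2, g3, 1:]) \<and>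
     (\<exists>h1 h2 h3 h4 h5. \<phi> (yf E) = [:\<eta>, h1, h2, h3, h4, h5, 1:])"

text \<open>The Anderson motive is free of rank one over twisted polynomials on its generator; an element
  \<open>\<omega> s_\<phi>\<close> is represented by \<open>\<omega>\<close>.  The action of \<open>A_L\<close> is the \<open>'l\<close>-linear extension (for
  multiplication by constants on the left) of \<open>a \<cdot> \<omega> = \<omega> \<phi>_a\<close>.\<close>

definition motive_act ::
    "nat \<Rightarrow> ('l::field, 'f::field) curve \<Rightarrow> ('f \<Rightarrow> 'l poly) \<Rightarrow> 'f \<Rightarrow> 'l poly \<Rightarrow> 'l poly" where
  "motive_act q E \<phi> g \<omega> = (case coords E g of (u, v) \<Rightarrow>
     (\<Sum>i\<le>Polynomial.degree u. smult (poly.coeff u i) (tmul q \<omega> (\<phi> (xf E ^ i)))) +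
     (\<Sum>i\<le>Polynomial.degree v. smult (poly.coeff v i) (tmul q \<omega> (\<phi> (xf E ^ i * yf E)))))"

abbreviation s\<^sub>\<phi> :: "'l::field poly" where
  "s\<^sub>\<phi> \<equiv> 1"

definition tau :: "nat \<Rightarrow> 'l::field poly \<Rightarrow> 'l poly" where
  "tau q \<omega> = tmul q (Polynomial.monom 1 1) \<omega>"

text \<open>The exterior square over \<open>A_L\<close> of the motive, as the free \<open>A_L\<close>-module on pairs of elements
  of the motive modulo the submodule \<open>wedge_rel\<close> generated by bilinearity and \<open>m \<wedge> m = 0\<close>.\<close>

definition wedge_free :: "('l::field, 'f::field) curve \<Rightarrow> (('l poly \<times> 'l poly) \<Rightarrow>\<^sub>0 'f) set" where
  "wedge_free E = {F. \<forall>p. Poly_Mapping.lookup F p \<in> coord_ring_L E}"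

inductive_set wedge_rel ::
    "nat \<Rightarrow> ('l::field, 'f::field) curve \<Rightarrow> ('f \<Rightarrow> 'l poly) \<Rightarrow> (('l poly \<times> 'l poly) \<Rightarrow>\<^sub>0 'f) set"
  for q :: nat and E :: "('l, 'f) curve" and \<phi> :: "'f \<Rightarrow> 'l poly" where
  add_left: "Poly_Mapping.single (m + m', n) 1 - Poly_Mapping.single (m, n) 1
       - Poly_Mapping.single (m', n) 1 \<in> wedge_rel q E \<phi>"
| add_right: "Poly_Mapping.single (m, n + n') 1 - Poly_Mapping.single (m, n) 1
       - Poly_Mapping.single (m, n') 1 \<in> wedge_rel q E \<phi>"
| act_left: "a \<in> coord_ring_L E \<Longrightarrow>
     Poly_Mapping.single (motive_act q E \<phi> a m, n) 1 - Poly_Mapping.single (m, n) a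
       \<in> wedge_rel q E \<phi>"
| act_right: "a \<in> coord_ring_L E \<Longrightarrow>
     Poly_Mapping.single (m, motive_act q E \<phi> a n) 1 - Poly_Mapping.single (m, n) a
       \<in> wedge_rel q E \<phi>"
| alternating: "Poly_Mapping.single (m, m) 1 \<in> wedge_rel q E \<phi>"
| sum: "F \<in> wedge_rel q E \<phi> \<Longrightarrow> G \<in> wedge_rel q E \<phi> \<Longrightarrow> F + G \<in> wedge_rel q E \<phi>"
| scale: "F \<in> wedge_rel q E \<phi> \<Longrightarrow> a \<in> coord_ring_L E \<Longrightarrow>
     Poly_Mapping.map ((*) a) F \<in> wedge_rel q E \<phi>"

definition wedge_value ::
    "('l::field poly \<Rightarrow> 'l poly \<Rightarrow> 'f::field) \<Rightarrow> (('l poly \<times> 'l poly) \<Rightarrow>\<^sub>0 'f) \<Rightarrow> 'f" where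
  "wedge_value w F = (\<Sum>p\<in>Poly_Mapping.keys F. Poly_Mapping.lookup F p * w (fst p) (snd p))"

text \<open>The exterior square of the motive is \<open>D^-1 A_L \<cdot> S0\<close>, and \<open>\<tau> S0 = c S0\<close>.
  Here \<open>w m n\<close> is the coordinate of \<open>m \<wedge> n\<close>, that is, \<open>m \<wedge> n = w m n \<cdot> S0\<close>.  The first two
  conditions say that \<open>F \<mapsto> wedge_value w F\<close> induces an isomorphism of \<open>A_L\<close>-modules from the
  exterior square, free module modulo relations, onto \<open>D^-1 A_L\<close>; the last one expresses
  \<open>\<tau>(m \<wedge> n) = \<tau> m \<wedge> \<tau> n\<close> and \<open>\<tau>(g S0) = g^(1) c S0\<close>.\<close>

definition wedge_coordinate ::
    "nat \<Rightarrow> ('l::field, 'f::field) curve \<Rightarrow> ('f \<Rightarrow> 'l poly) \<Rightarrow> 'l divisor \<Rightarrow> 'f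
      \<Rightarrow> ('l poly \<Rightarrow> 'l poly \<Rightarrow> 'f) \<Rightarrow> bool" where
  "wedge_coordinate q E \<phi> D c w \<longleftrightarrow>
     (\<forall>F\<in>wedge_free E. wedge_value w F = 0 \<longleftrightarrow> F \<in> wedge_rel q E \<phi>) \<and>
     wedge_value w ` wedge_free E = inv_ideal E D \<and>
     (\<forall>m n. w (tau q m) (tau q n) = twist q E (w m n) * c)"

definition normalized_relation ::
    "nat \<Rightarrow> ('l::field, 'f::field) curve \<Rightarrow> ('f \<Rightarrow> 'l poly) \<Rightarrow> 'f \<Rightarrow> 'f \<Rightarrow> 'f \<Rightarrow> bool" where
  "normalized_relation q E \<phi> C2 C1 C0 \<longleftrightarrow>
     (let x = xf E; y = yf E; k = emb E in
       (\<exists>c1 c0. C2 = x ^ 2 + k c1 * x + k c0) \<and>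
       (\<exists>d3 d2 d1 d0. C1 = k d3 * x ^ 2 + k d2 * y + k d1 * x + k d0) \<and>
       (\<exists>e3 e2 e1 e0. C0 = x * y + k e3 * x ^ 2 + k e2 * y + k e1 * x + k e0)) \<and>
     motive_act q E \<phi> C2 (tau q (tau q s\<^sub>\<phi>)) =
       motive_act q E \<phi> C1 (tau q s\<^sub>\<phi>) + motive_act q E \<phi> C0 s\<^sub>\<phi>"

text \<open>The definite article is part of the notion.  Some Drinfeld modules have more than one relation
  of this shape, for instance those obtained by restricting a sign-normalized rank-one Drinfeld
  module over \<open>A\<close> with constants extended to the field with \<open>q^2\<close> elements: then
  \<open>(x - c) \<tau>^2 s_\<phi> = (y - \<eta> - m'(x - \<theta>)) s_\<phi>\<close> for some \<open>c\<close> and \<open>m'\<close>, and this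
  may be multiplied by any \<open>x - e\<close>.\<close>

definition the_normalized_relation ::
    "nat \<Rightarrow> ('l::field, 'f::field) curve \<Rightarrow> ('f \<Rightarrow> 'l poly) \<Rightarrow> 'f \<Rightarrow> 'f \<Rightarrow> 'f \<Rightarrow> bool" where
  "the_normalized_relation q E \<phi> C2 C1 C0 \<longleftrightarrow>
     normalized_relation q E \<phi> C2 C1 C0 \<and>
     (\<forall>D2 D1 D0. normalized_relation q E \<phi> D2 D1 D0 \<longrightarrow> D2 = C2 \<and> D1 = C1 \<and> D0 = C0)"

end

theory Submission
  imports Defs
begin

text \<open>
  Write \<open>l = y - \<beta>\<^sup>\<or> - \<kappa> (x - \<alpha>)\<close> for the line through \<open>V\<^sup>\<or>\<close>, \<open>V'\<close>, \<open>V''\<close>. Its conjugate under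
  \<open>P \<mapsto> P\<^sup>\<or>\<close> is \<open>- C1'\<close>, and the product \<open>l C1'\<close> is a monic cubic in \<open>x\<close> vanishing at \<open>\<alpha>\<close>, which gives
  \<open>l C1' = (x - \<alpha>) C2\<close> (\<open>line_product\<close>). Both \<open>h l\<close> and \<open>x - \<alpha>\<close> have divisor \<open>V + V\<^sup>\<or> - 2 \<infinity>\<close> and sign
  one, so \<open>h l = x - \<alpha>\<close> (\<open>h_times_line\<close>) and \<open>C1' = h C2\<close>. It remains to produce one normalized
  relation with these \<open>C2\<close> and \<open>C0\<close>: a Drinfeld module with a unique normalized relation has no other.

  The tool is the exterior square. The motive has rank two and no torsion, so an element whose wedge
  products with \<open>s\<close> and \<open>\<tau> s\<close> both vanish is zero (\<open>wedge_nondegenerate\<close>). Wedging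
  \<open>C2 \<tau>\<^sup>2 s = C1 \<tau> s + C0 s\<close> with \<open>\<tau> s\<close> turns it into \<open>C0 = C1' f\<^sub>\<alpha> / h^(1)\<close>, because
  \<open>\<tau> S\<^sub>0 = - f\<^sub>\<alpha> S\<^sub>0\<close>. Since \<open>f\<^sub>\<alpha> / h^(1)\<close> has poles only in \<open>V + 2 \<infinity>\<close>, it is a combination of \<open>x\<close>, \<open>1\<close> and
  \<open>1 / h\<close>; the coefficients are \<open>1\<close>, \<open>\<gamma>\<^sub>1\<close>, \<open>\<gamma>\<^sub>2\<close> (\<open>twisted_line_product\<close>).

  Wedging with \<open>s\<close> turns the relation into \<open>C1 = C1' g\<close>, where \<open>s \<and> \<tau>\<^sup>2 s = g S\<^sub>0\<close>. By hypothesis \<open>g\<close> has at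
  most a simple pole at \<open>V\<close> and no other finite pole, so \<open>r = (x - \<alpha>) g\<close> lies in \<open>A_L\<close> and vanishes at
  \<open>V\<^sup>\<or>\<close> (\<open>inv_ideal_clear\<close>). A function of pole order \<open>d\<close> raises degrees in \<open>\<tau>\<close> by \<open>2 d\<close> (\<open>act_degree\<close>), and
  \<open>C2 \<tau>\<^sup>2 s - C0 s\<close> has degree at most ten; hence \<open>r\<close> has pole order at most three. Such functions are
  spanned by \<open>l\<close> and \<open>x - \<alpha>\<close>, so \<open>C1\<close> is a combination of \<open>C2\<close> and \<open>C1'\<close>.

  The divisors in the hypotheses are given by orders in local rings. To use them, the local rings are
  shown to be discrete valuation rings, at affine points by means of the nonvanishing discriminant,
  and a function that is regular at all affine points is shown to lie in \<open>A_L\<close> (\<open>regular_imp_AL\<close>).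
\<close>

section \<open>The coordinate ring\<close>

lemma map_poly_hom_add:
  fixes f :: "'a::comm_ring_1 \<Rightarrow> 'b::comm_ring_1"
  assumes "f 0 = 0" "\<And>a b. f (a + b) = f a + f b"
  shows "map_poly f (p + r) = map_poly f p + map_poly f r"
  by (intro poly_eqI) (simp add: coeff_map_poly assms)

lemma map_poly_hom_mult:
  fixes f :: "'a::comm_ring_1 \<Rightarrow> 'b::comm_ring_1"
  assumes f: "f 0 = 0" "\<And>a b. f (a + b) = f a + f b" "\<And>a b. f (a * b) = f a * f b"
  shows "map_poly f (p * r) = map_poly f p * map_poly f r"
proof (induction p)
  case 0
  show ?case by simp
next
  case (pCons a p)
  have smult: "map_poly f (smult a r) = smult (f a) (map_poly f r)"
    by (intro poly_eqI) (simp add: coeff_map_poly f)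
  have "map_poly f (pCons 0 (p * r)) = pCons 0 (map_poly f (p * r))"
    by (intro poly_eqI) (simp add: coeff_map_poly f coeff_pCons split: nat.splits)
  moreover have "map_poly f (pCons a p) = pCons (f a) (map_poly f p)"
    by (intro poly_eqI) (simp add: coeff_map_poly f coeff_pCons split: nat.splits)
  ultimately show ?case
    by (simp add: mult_pCons_left map_poly_hom_add[of f] f smult pCons.IH)
qed

locale weierstrass_field =
  fixes E :: "('l::alg_closed_field, 'f::field) curve"
  assumes function_field: "function_field E"
begin

abbreviation k :: "'l \<Rightarrow> 'f" where "k \<equiv> emb E"
abbreviation x :: 'f where "x \<equiv> xf E"
abbreviation y :: 'f where "y \<equiv> yf E"
abbreviation AL :: "'f set" where "AL \<equiv> coord_ring_L E"

lemma emb_1 [simp]: "k 1 = 1"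
  and emb_add [simp]: "k (c + d) = k c + k d"
  and emb_mult [simp]: "k (c * d) = k c * k d"
  using function_field unfolding function_field_def by blast+

lemma emb_0 [simp]: "k 0 = 0"
  using emb_add[of 0 0] by (metis add_cancel_left_left add_0)

lemma emb_minus [simp]: "k (- c) = - k c"
  using emb_add[of c "- c"] by (simp add: eq_neg_iff_add_eq_0 add.commute)

lemma emb_diff [simp]: "k (c - d) = k c - k d"
  using emb_add[of c "- d"] by simp

lemma emb_power [simp]: "k (c ^ i) = k c ^ i"
  by (induction i) simp_all

lemma emb_numeral [simp]: "k (numeral i) = numeral i"
proof -
  have "k (of_nat j) = of_nat j" for j :: nat by (induction j) simp_all
  then show ?thesis by (metis of_nat_numeral)
qed

lemma emb_eq_0_iff [simp]: "k c = 0 \<longleftrightarrow> c = 0"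
proof
  assume "k c = 0"
  show "c = 0"
  proof (rule ccontr)
    assume "c \<noteq> 0"
    then have "k c * k (inverse c) = 1" by (simp flip: emb_mult)
    with \<open>k c = 0\<close> show False by simp
  qed
qed simp

lemma emb_inject [simp]: "k c = k d \<longleftrightarrow> c = d"
  using emb_eq_0_iff[of "c - d"] by auto

definition at_x :: "'l poly \<Rightarrow> 'f" where
  "at_x u = poly (map_poly k u) x"

lemma at_x_add [simp]: "at_x (u + v) = at_x u + at_x v"
  by (simp add: at_x_def map_poly_hom_add)

lemma at_x_mult [simp]: "at_x (u * v) = at_x u * at_x v"
  by (simp add: at_x_def map_poly_hom_mult)

lemma at_x_pCons [simp]: "at_x (pCons c u) = k c + x * at_x u"
  by (simp add: at_x_def map_poly_pCons)

lemma at_x_0 [simp]: "at_x 0 = 0"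
  by (simp add: at_x_def)

lemma at_x_1 [simp]: "at_x 1 = 1"
  by (simp add: at_x_def)

lemma at_x_minus [simp]: "at_x (- u) = - at_x u"
  using at_x_add[of u "- u"] by (simp add: eq_neg_iff_add_eq_0 add.commute)

lemma at_x_diff [simp]: "at_x (u - v) = at_x u - at_x v"
  using at_x_add[of u "- v"] by simp

lemma at_x_smult [simp]: "at_x (smult c u) = k c * at_x u"
  using at_x_mult[of "[:c:]" u] by (simp del: at_x_mult)

lemma elt_conv: "elt E u v = at_x u + at_x v * y"
  by (simp add: elt_def at_x_def)

text \<open>The Weierstrass equation reads \<open>y\<^sup>2 = cubic - lin_part \<cdot> y\<close> with these polynomials in \<open>x\<close>.\<close>

definition cubic :: "'l poly" where
  "cubic = [:a\<^sub>6 E, a\<^sub>4 E, a\<^sub>2 E, 1:]"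

definition lin_part :: "'l poly" where
  "lin_part = [:a\<^sub>3 E, a\<^sub>1 E:]"

lemma y_square: "y * y = at_x cubic - at_x lin_part * y"
proof -
  have "y ^ 2 + k (a\<^sub>1 E) * x * y + k (a\<^sub>3 E) * y
      = x ^ 3 + k (a\<^sub>2 E) * x ^ 2 + k (a\<^sub>4 E) * x + k (a\<^sub>6 E)"
    using function_field unfolding function_field_def by blast
  then show ?thesis
    by (simp add: cubic_def lin_part_def algebra_simps power2_eq_square power3_eq_cube eq_diff_eq)
qed

lemma on_curve_iff: "on_curve E (Affine a b) \<longleftrightarrow> b * b = poly cubic a - poly lin_part a * b"
  by (simp add: cubic_def lin_part_def algebra_simps power2_eq_square power3_eq_cube eq_diff_eq)

lemma elt_eq_0_iff [simp]: "elt E u v = 0 \<longleftrightarrow> u = 0 \<and> v = 0"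
proof
  show "elt E u v = 0 \<Longrightarrow> u = 0 \<and> v = 0"
    using function_field unfolding function_field_def by blast
qed (simp add: elt_conv)

lemma elt_add: "elt E u v + elt E u' v' = elt E (u + u') (v + v')"
  by (simp add: elt_conv algebra_simps)

lemma elt_diff: "elt E u v - elt E u' v' = elt E (u - u') (v - v')"
  by (simp add: elt_conv algebra_simps)

lemma elt_mult:
  "elt E u v * elt E u' v' =
     elt E (u * u' + v * v' * cubic) (u * v' + u' * v - v * v' * lin_part)"
proof -
  have "elt E u v * elt E u' v' = at_x u * at_x u' + (at_x u * at_x v' + at_x u' * at_x v) * y
      + at_x v * at_x v' * (y * y)"
    by (simp add: elt_conv algebra_simps)
  also have "\<dots> = elt E (u * u' + v * v' * cubic) (u * v' + u' * v - v * v' * lin_part)"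
    unfolding y_square by (simp add: elt_conv algebra_simps)
  finally show ?thesis .
qed

lemma elt_inject [simp]: "elt E u v = elt E u' v' \<longleftrightarrow> u = u' \<and> v = v'"
  using elt_eq_0_iff[of "u - u'" "v - v'"] elt_diff[of u v u' v'] by auto

lemma coords_elt [simp]: "coords E (elt E u v) = (u, v)"
  unfolding coords_def by (rule the_equality) auto

lemma eval_elt [simp]: "eval_at E a b (elt E u v) = poly u a + poly v a * b"
  by (simp add: eval_at_def)

lemma AL_elt [simp]: "elt E u v \<in> AL"
  by (auto simp: coord_ring_L_def)

lemma AL_cases: "g \<in> AL \<Longrightarrow> (\<And>u v. g = elt E u v \<Longrightarrow> P) \<Longrightarrow> P"
  by (auto simp: coord_ring_L_def)

lemma AL_add: "f \<in> AL \<Longrightarrow> g \<in> AL \<Longrightarrow> f + g \<in> AL"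
  by (elim AL_cases) (simp add: elt_add)

lemma AL_diff: "f \<in> AL \<Longrightarrow> g \<in> AL \<Longrightarrow> f - g \<in> AL"
  by (elim AL_cases) (simp add: elt_diff)

lemma AL_mult: "f \<in> AL \<Longrightarrow> g \<in> AL \<Longrightarrow> f * g \<in> AL"
  by (elim AL_cases) (simp add: elt_mult)

lemma at_x_elt: "at_x u = elt E u 0"
  by (simp add: elt_conv)

lemma x_elt: "x = elt E [:0, 1:] 0"
  by (simp add: elt_conv)

lemma y_elt: "y = elt E 0 1"
  by (simp add: elt_conv)

lemma emb_elt: "k c = elt E [:c:] 0"
  by (simp add: elt_conv)

lemma AL_at_x [simp]: "at_x u \<in> AL"
  by (simp add: at_x_elt)

lemma AL_x [simp]: "x \<in> AL" and AL_y [simp]: "y \<in> AL" and AL_emb [simp]: "k c \<in> AL"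
  by (simp_all only: x_elt y_elt emb_elt AL_elt)

lemma AL_1 [simp]: "1 \<in> AL" and AL_0 [simp]: "0 \<in> AL"
  using AL_emb[of 1] AL_emb[of 0] by simp_all

lemma AL_minus: "f \<in> AL \<Longrightarrow> - f \<in> AL"
  using AL_diff[of 0 f] by simp

lemma AL_power: "f \<in> AL \<Longrightarrow> f ^ i \<in> AL"
  by (induction i) (simp_all add: AL_mult)

lemmas AL_intros = AL_add AL_diff AL_mult AL_minus AL_power AL_x AL_y AL_emb AL_1 AL_0

lemma fraction: obtains a b where "a \<in> AL" "b \<in> AL" "b \<noteq> 0" "g = a / b"
  using function_field unfolding function_field_def by blast

lemma eval_x [simp]: "eval_at E a b x = a"
  and eval_y [simp]: "eval_at E a b y = b"
  and eval_emb [simp]: "eval_at E a b (k c) = c"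
  by (simp_all only: x_elt y_elt emb_elt eval_elt) simp_all

lemma eval_1 [simp]: "eval_at E a b 1 = 1" and eval_0 [simp]: "eval_at E a b 0 = 0"
  using eval_emb[of a b 1] eval_emb[of a b 0] by simp_all

lemma eval_add [simp]:
  "f \<in> AL \<Longrightarrow> g \<in> AL \<Longrightarrow> eval_at E a b (f + g) = eval_at E a b f + eval_at E a b g"
  by (elim AL_cases) (simp add: elt_add algebra_simps)

lemma eval_diff [simp]:
  "f \<in> AL \<Longrightarrow> g \<in> AL \<Longrightarrow> eval_at E a b (f - g) = eval_at E a b f - eval_at E a b g"
  by (elim AL_cases) (simp add: elt_diff algebra_simps)

lemma eval_mult [simp]:
  assumes "on_curve E (Affine a b)" "f \<in> AL" "g \<in> AL"
  shows "eval_at E a b (f * g) = eval_at E a b f * eval_at E a b g"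
proof -
  obtain u v u' v' where "f = elt E u v" "g = elt E u' v'"
    using assms by (elim AL_cases) blast
  moreover have "(poly u a + poly v a * b) * (poly u' a + poly v' a * b) =
      poly u a * poly u' a + (poly u a * poly v' a + poly u' a * poly v a) * b
        + poly v a * poly v' a * (b * b)"
    by (simp add: algebra_simps)
  ultimately show ?thesis
    using assms(1) unfolding on_curve_iff by (simp add: elt_mult) (simp add: algebra_simps)
qed

text \<open>The factor \<open>f'\<close> is the conjugate of \<open>f\<close> under \<open>P \<mapsto> P\<^sup>\<or>\<close>. The lemma serves to move denominators
  into \<open>L[x]\<close> and to bound the order of \<open>f\<close> at a point by the order of its norm.\<close>

lemma norm_in_polys:
  assumes "f \<in> AL" "f \<noteq> 0"
  obtains f' d where "f' \<in> AL" "d \<noteq> 0" "f * f' = at_x d"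
proof -
  obtain u v where f: "f = elt E u v" using assms by (elim AL_cases)
  define f' where "f' = elt E (u - v * lin_part) (- v)"
  have "f' \<noteq> 0" using assms(2) by (auto simp: f f'_def)
  have eq: "f * f' = at_x (u * (u - v * lin_part) - v * v * cubic)"
    by (simp add: f f'_def elt_mult at_x_elt algebra_simps)
  moreover have "u * (u - v * lin_part) - v * v * cubic \<noteq> 0"
    using eq \<open>f' \<noteq> 0\<close> assms(2) by (metis at_x_0 mult_eq_0_iff)
  moreover have "f' \<in> AL" by (simp add: f'_def)
  ultimately show ?thesis using that by blast
qed

section \<open>Pole order and sign at infinity\<close>

text \<open>Substituting \<open>z\<^sup>2\<close> for \<open>x\<close> and \<open>z\<^sup>3\<close> for \<open>y\<close> in the normal form makes the pole order a
  degree and the sign a leading coefficient, because even and odd exponents cannot cancel.\<close>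

definition weight_poly :: "'l poly \<Rightarrow> 'l poly \<Rightarrow> 'l poly" where
  "weight_poly u v = pcompose u (monom 1 2) + monom 1 3 * pcompose v (monom 1 2)"

lemma degree_even_part: "degree (pcompose u (monom (1::'l) 2)) = 2 * degree u"
  by (simp add: degree_pcompose degree_monom_eq)

lemma lead_even_part: "lead_coeff (pcompose u (monom (1::'l) 2)) = lead_coeff u"
  by (simp add: lead_coeff_comp degree_monom_eq)

lemma even_part_eq_0: "pcompose u (monom (1::'l) 2) = 0 \<longleftrightarrow> u = 0"
  by (rule pcompose_eq_0_iff) (simp add: degree_monom_eq)

lemma degree_odd_part:
  "v \<noteq> 0 \<Longrightarrow> degree (monom 1 3 * pcompose v (monom (1::'l) 2)) = 2 * degree v + 3"
  by (subst degree_mult_eq) (auto simp: degree_even_part even_part_eq_0 degree_monom_eq)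

lemma lead_odd_part: "lead_coeff (monom 1 3 * pcompose v (monom (1::'l) 2)) = lead_coeff v"
  by (simp only: lead_coeff_mult lead_coeff_monom lead_even_part) simp

lemma weight_poly_pole_deg_sign:
  "degree (weight_poly u v) = pole_deg E (elt E u v) \<and>
   lead_coeff (weight_poly u v) = sign_ring E (elt E u v)"
proof (cases "v = 0")
  case True
  then show ?thesis
    using lead_even_part[of u] by (simp add: weight_poly_def pole_deg_def sign_ring_def degree_even_part)
next
  case v: False
  have "2 * degree u \<noteq> 2 * degree v + 3" by presburger
  then consider "2 * degree u > 2 * degree v + 3" | "2 * degree u < 2 * degree v + 3"
    by (rule linorder_neqE_nat)
  then show ?thesis
  proof cases
    case 1
    then show ?thesis
      using v lead_even_part[of u]
      by (simp add: weight_poly_def pole_deg_def sign_ring_def degree_add_eq_left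
          degree_even_part degree_odd_part coeff_eq_0)
  next
    case 2
    then show ?thesis
      using v lead_odd_part[of v] degree_odd_part[of v]
      by (simp add: weight_poly_def pole_deg_def sign_ring_def degree_add_eq_right
          degree_even_part degree_odd_part coeff_eq_0)
  qed
qed

lemma weight_poly_eq_0_iff: "weight_poly u v = 0 \<longleftrightarrow> u = 0 \<and> v = 0"
proof
  assume "weight_poly u v = 0"
  then have "sign_ring E (elt E u v) = 0"
    using weight_poly_pole_deg_sign[of u v] by simp
  then show "u = 0 \<and> v = 0"
    by (auto simp: sign_ring_def split: if_splits)
qed (simp add: weight_poly_def)

lemma degree_lin_part: "degree lin_part \<le> 1"
  by (simp add: lin_part_def)

text \<open>With \<open>x\<close> of weight two and \<open>y\<close> of weight three, the Weierstrass equation is \<open>y\<^sup>2 = x\<^sup>3\<close> plus terms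
  of lower weight. Hence the substitution, although not multiplicative, is so up to terms of lower
  degree.\<close>

lemma pole_deg_sign_mult:
  assumes "f \<in> AL" "g \<in> AL" "f \<noteq> 0" "g \<noteq> 0"
  shows "pole_deg E (f * g) = pole_deg E f + pole_deg E g \<and>
    sign_ring E (f * g) = sign_ring E f * sign_ring E g"
proof -
  obtain u v u' v' where f: "f = elt E u v" and g: "g = elt E u' v'"
    using assms by (elim AL_cases) blast
  let ?T = "weight_poly u v" and ?T' = "weight_poly u' v'"
  let ?z = "\<lambda>u. pcompose u (monom (1::'l) 2)"
  define U where "U = u * u' + v * v' * cubic"
  define V where "V = u * v' + u' * v - v * v' * lin_part"
  have nz: "?T \<noteq> 0" "?T' \<noteq> 0" using assms by (auto simp: f g weight_poly_eq_0_iff)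
  define R where "R = ?z (cubic - monom 1 3) - monom 1 3 * ?z lin_part"
  have z3: "?z (monom 1 3) = monom 1 3 * monom (1::'l) 3"
    by (simp add: numeral_3_eq_3 numeral_2_eq_2 monom_Suc pcompose_pCons monom_0)
  have split: "weight_poly U V = ?T * ?T' + ?z (v * v') * R"
    unfolding weight_poly_def U_def V_def R_def
    by (simp add: pcompose_add pcompose_diff pcompose_mult z3 algebra_simps)
  have degR: "degree R \<le> 5"
  proof -
    have "degree (cubic - monom 1 3) \<le> 2"
      by (rule degree_le) (auto simp: cubic_def coeff_pCons coeff_monom numeral_3_eq_3 split: nat.splits)
    then have "degree (?z (cubic - monom 1 3)) \<le> 5" by (simp add: degree_even_part)
    moreover have "degree (monom 1 3 * ?z lin_part) \<le> 5"
      using degree_lin_part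
      by (intro order_trans[OF degree_mult_le]) (simp add: degree_even_part degree_monom_eq)
    ultimately show ?thesis unfolding R_def by (intro degree_diff_le)
  qed
  have lower: "?z (v * v') * R = 0 \<or> degree (?z (v * v') * R) < degree (?T * ?T')"
  proof (cases "v = 0 \<or> v' = 0")
    case False
    then have "2 * degree v + 3 \<le> degree ?T" "2 * degree v' + 3 \<le> degree ?T'"
      using weight_poly_pole_deg_sign[of u v] weight_poly_pole_deg_sign[of u' v']
      by (simp_all add: pole_deg_def)
    moreover have "degree (?z (v * v') * R) \<le> 2 * degree v + 2 * degree v' + 5"
      using degR False
      by (intro order_trans[OF degree_mult_le]) (simp add: degree_even_part degree_mult_eq)
    ultimately show ?thesis using nz by (simp add: degree_mult_eq)
  qed auto
  have "degree (weight_poly U V) = degree (?T * ?T') \<and>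
      lead_coeff (weight_poly U V) = lead_coeff (?T * ?T')"
    using lower unfolding split by (auto simp: degree_add_eq_left coeff_eq_0)
  then have "degree (weight_poly U V) = degree ?T + degree ?T' \<and>
      lead_coeff (weight_poly U V) = lead_coeff ?T * lead_coeff ?T'"
    unfolding lead_coeff_mult unfolding degree_mult_eq[OF nz] .
  then show ?thesis
    unfolding f g elt_mult U_def[symmetric] V_def[symmetric]
      weight_poly_pole_deg_sign[THEN conjunct2, symmetric]
      weight_poly_pole_deg_sign[THEN conjunct1, symmetric] .
qed

lemmas pole_deg_mult = pole_deg_sign_mult[THEN conjunct1]
  and sign_ring_mult = pole_deg_sign_mult[THEN conjunct2]

lemma sign_ring_nz: "f \<in> AL \<Longrightarrow> f \<noteq> 0 \<Longrightarrow> sign_ring E f \<noteq> 0"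
  by (elim AL_cases) (auto simp: sign_ring_def)

lemma sign_fraction:
  assumes "f \<in> AL" "g \<in> AL" "f \<noteq> 0" "g \<noteq> 0"
  shows "sign E (f / g) = sign_ring E f / sign_ring E g"
  unfolding sign_def
proof (rule the_equality)
  show "\<exists>a\<in>AL. \<exists>b\<in>AL. a \<noteq> 0 \<and> b \<noteq> 0 \<and> f / g = a / b \<and>
      sign_ring E f / sign_ring E g = sign_ring E a / sign_ring E b"
    using assms by blast
next
  fix c
  assume "\<exists>a\<in>AL. \<exists>b\<in>AL. a \<noteq> 0 \<and> b \<noteq> 0 \<and> f / g = a / b \<and>
      c = sign_ring E a / sign_ring E b"
  then obtain a b where ab: "a \<in> AL" "b \<in> AL" "a \<noteq> 0" "b \<noteq> 0" "f / g = a / b"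
    and c: "c = sign_ring E a / sign_ring E b" by blast
  then have "f * b = a * g" using assms by (simp add: field_simps)
  then have "sign_ring E f * sign_ring E b = sign_ring E a * sign_ring E g"
    using ab assms by (metis sign_ring_mult)
  then show "c = sign_ring E f / sign_ring E g"
    using ab assms by (simp add: c sign_ring_nz frac_eq_eq)
qed

end

section \<open>Orders at points\<close>

text \<open>A discrete valuation ring \<open>R\<close> of a field with maximal ideal \<open>M\<close>, described by those
  multiplicative properties that determine the order: every nonzero element is a power of \<open>t\<close> times a
  unit.\<close>

locale local_parameter =
  fixes R M :: "'f::field set" and t :: 'f
  assumes mult: "a \<in> R \<Longrightarrow> b \<in> R \<Longrightarrow> a * b \<in> R"
    and ideal: "a \<in> R \<Longrightarrow> b \<in> M \<Longrightarrow> a * b \<in> M"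
    and M_sub: "M \<subseteq> R"
    and one: "1 \<in> R" "1 \<notin> M"
    and inverse_mem: "u \<in> R \<Longrightarrow> u \<notin> M \<Longrightarrow> inverse u \<in> R"
    and t: "t \<in> M" "t \<noteq> 0" and generates: "g \<in> M \<Longrightarrow> \<exists>r\<in>R. g = r * t"
    and factor: "g \<noteq> 0 \<Longrightarrow> \<exists>n u. u \<in> R - M \<and> g = t powi n * u"
begin

lemma unit_nz: "u \<in> R - M \<Longrightarrow> u \<noteq> 0"
  using ideal[of 0 t] t by auto

lemma unit_inverse: "u \<in> R - M \<Longrightarrow> inverse u \<in> R - M"
  using ideal[of u "inverse u"] one inverse_mem[of u] unit_nz[of u] by auto

lemma unit_mult: "u \<in> R - M \<Longrightarrow> v \<in> R - M \<Longrightarrow> u * v \<in> R - M"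
  using ideal[of "inverse u" "u * v"] mult[of u v] unit_inverse[of u] unit_nz[of u]
  by (auto simp: field_simps)

lemma unit_power: "u \<in> R - M \<Longrightarrow> u ^ i \<in> R - M"
  using one unit_mult by (induction i) auto

lemma unit_powi: "u \<in> R - M \<Longrightarrow> u powi n \<in> R - M"
  using unit_power unit_inverse by (auto simp: power_int_def)

lemma t_power: "t ^ Suc i \<in> M"
  using t M_sub by (induction i) (auto intro: ideal)

lemma t_powi: "n \<ge> 1 \<Longrightarrow> t powi n \<in> M"
  using t_power[of "nat n - 1"] by (simp add: power_int_def)

lemma
  assumes u: "u \<in> R - M"
  shows mem_R_iff: "t powi n * u \<in> R \<longleftrightarrow> n \<ge> 0" and mem_M_iff: "t powi n * u \<in> M \<longleftrightarrow> n \<ge> 1"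
proof -
  have pos: "t powi n * u \<in> M" if "n \<ge> 1" for n
    using ideal[OF _ t_powi[OF that]] u by (auto simp: mult.commute)
  have neg: "t powi n * u \<notin> R" if "n < 0" for n
  proof
    assume "t powi n * u \<in> R"
    moreover have "t powi (- n) \<in> M" using that by (intro t_powi) simp
    ultimately have "t powi n * u * t powi (- n) \<in> M" by (rule ideal)
    moreover have "t powi n * u * t powi (- n) = u"
      using t by (simp add: power_int_minus field_simps)
    ultimately show False using u by simp
  qed
  show "t powi n * u \<in> R \<longleftrightarrow> n \<ge> 0"
    using pos[of n] neg[of n] u M_sub by (cases n "0 :: int" rule: linorder_cases) auto
  show "t powi n * u \<in> M \<longleftrightarrow> n \<ge> 1"
    using pos[of n] neg[of n] u M_sub by (cases n "0 :: int" rule: linorder_cases) auto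
qed

lemma exponent_unique:
  assumes "u \<in> R - M" "v \<in> R - M" "t powi n * u = t powi i * v"
  shows "n = i"
proof -
  have "t powi (n - i) * u = v"
    using assms(3) t by (simp add: power_int_diff field_simps)
  then show ?thesis
    using mem_R_iff[OF assms(1), of "n - i"] mem_M_iff[OF assms(1), of "n - i"] assms(2) by auto
qed

text \<open>Two generators of the maximal ideal differ by a unit, so the exponent does not depend on
  the generator.\<close>

lemma exponent_any_generator:
  assumes t': "t' \<in> M" "\<forall>g\<in>M. \<exists>r\<in>R. g = r * t'"
    and "u \<in> R - M" "v \<in> R - M" "t powi n * u = t' powi i * v"
  shows "n = i"
proof -
  obtain r r' where r: "r \<in> R" "t' = r * t" and r': "r' \<in> R" "t = r' * t'"
    using t' t generates by meson
  have "r' * r = 1" using r r' t by (metis mult.assoc mult_cancel_right1)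
  then have "r \<notin> M" using ideal[OF r'(1), of r] one by auto
  then have "r powi i * v \<in> R - M" using r assms unit_mult unit_powi by blast
  moreover have "t powi n * u = t powi i * (r powi i * v)"
    using assms(5) r(2) by (simp add: power_int_mult_distrib mult_ac)
  ultimately show ?thesis using exponent_unique assms by blast
qed

text \<open>The form of this definition is that of the order at a point.\<close>

definition val :: "'f \<Rightarrow> int" where
  "val g = (THE n. \<exists>t r. (t \<in> M \<and> (\<forall>g\<in>M. \<exists>r\<in>R. g = r * t)) \<and> r \<in> R - M \<and> g = t powi n * r)"

lemma val_eq:
  assumes "u \<in> R - M"
  shows "val (t powi n * u) = n"
  unfolding val_def
proof (rule the_equality)
  show "\<exists>t' r. (t' \<in> M \<and> (\<forall>g\<in>M. \<exists>r\<in>R. g = r * t')) \<and> r \<in> R - M \<and>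
      t powi n * u = t' powi n * r"
    using t generates assms by blast
qed (use exponent_any_generator assms in blast)

lemma val_mult:
  assumes "f \<noteq> 0" "g \<noteq> 0"
  shows "val (f * g) = val f + val g"
proof -
  obtain i u j v where "u \<in> R - M" "f = t powi i * u" "v \<in> R - M" "g = t powi j * v"
    using factor assms by meson
  moreover from this have "f * g = t powi (i + j) * (u * v)"
    using t by (simp add: power_int_add)
  ultimately show ?thesis by (simp only: val_eq unit_mult)
qed

lemma val_nonneg_iff: "f \<noteq> 0 \<Longrightarrow> 0 \<le> val f \<longleftrightarrow> f \<in> R"
  and val_pos_iff: "f \<noteq> 0 \<Longrightarrow> 1 \<le> val f \<longleftrightarrow> f \<in> M"
  using factor[of f] val_eq mem_R_iff mem_M_iff by metis+

end

locale elliptic_field = weierstrass_field E for E :: "('l::alg_closed_field, 'f::field) curve" +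
  assumes discriminant: "discriminant E \<noteq> 0"
begin

text \<open>At a singular point the curve equation and its two partial derivatives determine \<open>a\<^sub>3\<close>, \<open>a\<^sub>4\<close>, \<open>a\<^sub>6\<close>
  from the point and \<open>a\<^sub>1\<close>, \<open>a\<^sub>2\<close>. With these values the discriminant vanishes identically, which is
  best seen through \<open>b4\<close>, \<open>b6\<close>, \<open>b8\<close>: they become polynomials in \<open>a\<close> and \<open>b2\<close> alone.\<close>

lemma nonsingular:
  assumes "on_curve E (Affine a b)" "2 * b + a\<^sub>1 E * a + a\<^sub>3 E = 0"
  shows "3 * a ^ 2 + 2 * a\<^sub>2 E * a + a\<^sub>4 E - a\<^sub>1 E * b \<noteq> 0"
proof
  assume *: "3 * a ^ 2 + 2 * a\<^sub>2 E * a + a\<^sub>4 E - a\<^sub>1 E * b = 0"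
  have a3: "a\<^sub>3 E = - 2 * b - a\<^sub>1 E * a" using assms(2) by algebra
  have a4: "a\<^sub>4 E = a\<^sub>1 E * b - 3 * a ^ 2 - 2 * a\<^sub>2 E * a" using * by algebra
  have a6: "a\<^sub>6 E = b ^ 2 + a\<^sub>1 E * a * b + a\<^sub>3 E * b - a ^ 3 - a\<^sub>2 E * a ^ 2 - a\<^sub>4 E * a"
    using assms(1) by (simp add: algebra_simps)
  define b2 where "b2 = a\<^sub>1 E ^ 2 + 4 * a\<^sub>2 E"
  define b4 where "b4 = 2 * a\<^sub>4 E + a\<^sub>1 E * a\<^sub>3 E"
  define b6 where "b6 = a\<^sub>3 E ^ 2 + 4 * a\<^sub>6 E"
  define b8 where "b8 = a\<^sub>1 E ^ 2 * a\<^sub>6 E + 4 * a\<^sub>2 E * a\<^sub>6 E - a\<^sub>1 E * a\<^sub>3 E * a\<^sub>4 E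
              + a\<^sub>2 E * a\<^sub>3 E ^ 2 - a\<^sub>4 E ^ 2"
  have b4: "b4 = - 6 * a ^ 2 - b2 * a"
    unfolding b4_def b2_def a4 a3 by algebra
  have b6: "b6 = 8 * a ^ 3 + b2 * a ^ 2"
    unfolding b6_def b2_def a6 a4 a3 by algebra
  have b8: "b8 = - (3 * a ^ 4 + b2 * a ^ 3 + 3 * b4 * a ^ 2 + 3 * b6 * a)"
    unfolding b8_def b6 b4 b2_def a6 a4 a3 by algebra
  have "discriminant E = - (b2 ^ 2 * b8) - 8 * b4 ^ 3 - 27 * b6 ^ 2 + 9 * b2 * b4 * b6"
    by (simp add: discriminant_def Let_def b2_def b4_def b6_def b8_def)
  also have "\<dots> = 0"
    unfolding b8 b6 b4 by algebra
  finally show False using discriminant by simp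
qed

lemma local_ring_affineI:
  "f \<in> AL \<Longrightarrow> g \<in> AL \<Longrightarrow> eval_at E a b g \<noteq> 0 \<Longrightarrow> f / g \<in> local_ring E (Affine a b)"
  by auto

lemma max_ideal_affineI:
  "f \<in> AL \<Longrightarrow> g \<in> AL \<Longrightarrow> eval_at E a b g \<noteq> 0 \<Longrightarrow> eval_at E a b f = 0 \<Longrightarrow>
    f / g \<in> max_ideal E (Affine a b)"
  by auto

lemma local_ring_infinityI:
  "f \<in> AL \<Longrightarrow> g \<in> AL \<Longrightarrow> g \<noteq> 0 \<Longrightarrow> f = 0 \<or> pole_deg E f \<le> pole_deg E g \<Longrightarrow>
    f / g \<in> local_ring E Infinity"
  by auto

lemma max_ideal_infinityI:
  "f \<in> AL \<Longrightarrow> g \<in> AL \<Longrightarrow> g \<noteq> 0 \<Longrightarrow> f = 0 \<or> pole_deg E f < pole_deg E g \<Longrightarrow>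
    f / g \<in> max_ideal E Infinity"
  by auto

lemma local_ring_affineE:
  assumes "h \<in> local_ring E (Affine a b)"
  obtains f g where "h = f / g" "f \<in> AL" "g \<in> AL" "eval_at E a b g \<noteq> 0"
  using assms by auto

lemma max_ideal_affineE:
  assumes "h \<in> max_ideal E (Affine a b)"
  obtains f g where "h = f / g" "f \<in> AL" "g \<in> AL" "eval_at E a b g \<noteq> 0" "eval_at E a b f = 0"
  using assms by auto

lemma local_ring_infinityE:
  assumes "h \<in> local_ring E Infinity"
  obtains f g where "h = f / g" "f \<in> AL" "g \<in> AL" "g \<noteq> 0" "f = 0 \<or> pole_deg E f \<le> pole_deg E g"
  using assms by auto

lemma max_ideal_infinityE:
  assumes "h \<in> max_ideal E Infinity"
  obtains f g where "h = f / g" "f \<in> AL" "g \<in> AL" "g \<noteq> 0" "f = 0 \<or> pole_deg E f < pole_deg E g"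
  using assms by auto

declare local_ring.simps [simp del] max_ideal.simps [simp del]

lemma local_ring_AL: "f \<in> AL \<Longrightarrow> f \<in> local_ring E (Affine a b)"
  using local_ring_affineI[of f 1] by simp

lemma max_ideal_AL: "f \<in> AL \<Longrightarrow> eval_at E a b f = 0 \<Longrightarrow> f \<in> max_ideal E (Affine a b)"
  using max_ideal_affineI[of f 1] by simp

context
  fixes a b assumes P: "on_curve E (Affine a b)"
begin

lemmas eval_mult_P [simp] = eval_mult[OF P]

lemma max_ideal_eval:
  assumes "f \<in> max_ideal E (Affine a b)" "f \<in> AL"
  shows "eval_at E a b f = 0"
proof -
  obtain f' g where "f = f' / g" "f' \<in> AL" "g \<in> AL" "eval_at E a b g \<noteq> 0" "eval_at E a b f' = 0"
    using assms(1) by (rule max_ideal_affineE)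
  moreover from this have "f * g = f'" by auto
  ultimately show ?thesis using eval_mult_P[of f g] assms by auto
qed

lemma unit_AL:
  "f \<in> AL \<Longrightarrow> eval_at E a b f \<noteq> 0 \<Longrightarrow> f \<in> local_ring E (Affine a b) - max_ideal E (Affine a b)"
  using max_ideal_eval local_ring_AL by blast

text \<open>The maximal ideal at \<open>(a, b)\<close> is generated by \<open>x - a\<close> and \<open>y - b\<close>, and the curve equation reads
  \<open>(y - b) (y - b\<^sup>\<or>) = (x - a) \<cdot> cofactor\<close>. If the point is not of order two, then \<open>y - b\<^sup>\<or>\<close> is a unit and
  \<open>x - a\<close> generates the ideal; otherwise the cofactor, whose value is the partial derivative by \<open>x\<close> up
  to sign, is a unit and \<open>y - b\<close> generates.\<close>

definition cofactor :: 'f where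
  "cofactor = x * x + k a * x + k (a * a) + k (a\<^sub>2 E) * (x + k a) + k (a\<^sub>4 E) - k (a\<^sub>1 E) * y"

lemma cofactor_AL: "cofactor \<in> AL"
  unfolding cofactor_def by (intro AL_intros)

lemma eval_cofactor: "eval_at E a b cofactor = 3 * a ^ 2 + 2 * a\<^sub>2 E * a + a\<^sub>4 E - a\<^sub>1 E * b"
  unfolding cofactor_def using P
  by (simp add: AL_intros del: emb_mult) (simp add: algebra_simps power2_eq_square)

lemma cofactor_eq:
  "(y - k b) * (y - k (- b - a\<^sub>1 E * a - a\<^sub>3 E)) = (x - k a) * cofactor"
proof -
  have 1: "y * y = at_x cubic - at_x lin_part * y" by (rule y_square)
  have 2: "k b * k b = k (poly cubic a - poly lin_part a * b)"
    using P unfolding on_curve_iff by (metis emb_mult)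
  show ?thesis
    using 1 2 unfolding cofactor_def cubic_def lin_part_def by simp algebra
qed

lemma max_ideal_gens:
  assumes "f \<in> AL" "eval_at E a b f = 0"
  obtains g c where "g \<in> AL" "f = (x - k a) * g + k c * (y - k b)"
proof -
  obtain u v where f: "f = elt E u v" using assms by (elim AL_cases)
  have div: "at_x w = k (poly w a) + (x - k a) * at_x (synthetic_div w a)" for w
    using arg_cong[OF synthetic_div_correct'[of a w], of at_x] by (simp add: algebra_simps)
  have "k (poly u a) = - k (poly v a) * k b"
    using assms(2) f by (metis add_eq_0_iff2 emb_minus emb_mult eval_elt mult_minus_left)
  then have "f = (x - k a) * elt E (synthetic_div u a) (synthetic_div v a) + k (poly v a) * (y - k b)"
    unfolding f elt_conv by (subst div[of u], subst div[of v]) (simp add: algebra_simps)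
  then show ?thesis using that by (metis AL_elt)
qed

text \<open>The norm of a function is a polynomial in \<open>x\<close>, hence a power of \<open>x - a\<close>, and so of \<open>t\<close>, times a unit.
  This bounds how often \<open>t\<close> can be split off from the function.\<close>

lemma affine_local_parameter:
  assumes t: "t \<in> AL" "eval_at E a b t = 0" "t \<noteq> 0"
    and gen: "\<And>f. f \<in> AL \<Longrightarrow> eval_at E a b f = 0 \<Longrightarrow> \<exists>r\<in>local_ring E (Affine a b). f = r * t"
    and ram: "x - k a = t ^ e * c" "c \<in> local_ring E (Affine a b) - max_ideal E (Affine a b)"
  shows "local_parameter (local_ring E (Affine a b)) (max_ideal E (Affine a b)) t"
proof -
  let ?R = "local_ring E (Affine a b)" and ?M = "max_ideal E (Affine a b)"
  have mult: "f * g \<in> ?R" if "f \<in> ?R" "g \<in> ?R" for f g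
    using that by (elim local_ring_affineE)
      (auto simp: AL_mult pole_deg_mult intro!: local_ring_affineI)
  have ideal: "f * g \<in> ?M" if "f \<in> ?R" "g \<in> ?M" for f g
    using that by (elim local_ring_affineE max_ideal_affineE)
      (auto simp: AL_mult pole_deg_mult intro!: max_ideal_affineI)
  have M_sub: "?M \<subseteq> ?R" by (auto elim!: max_ideal_affineE intro: local_ring_affineI)
  have one: "1 \<in> ?R - ?M" by (rule unit_AL) simp_all
  have inv: "inverse u \<in> ?R" if u: "u \<in> ?R" "u \<notin> ?M" for u
  proof -
    obtain f g where fg: "u = f / g" "f \<in> AL" "g \<in> AL" "eval_at E a b g \<noteq> 0"
      using u(1) by (rule local_ring_affineE)
    moreover have "eval_at E a b f \<noteq> 0" using u(2) fg max_ideal_affineI by blast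
    ultimately show ?thesis using local_ring_affineI[of g f] by simp
  qed
  have tM: "t \<in> ?M" using t max_ideal_AL by blast
  have gens: "\<exists>r\<in>?R. g = r * t" if gM: "g \<in> ?M" for g
  proof -
    obtain f d where fd: "g = f / d" "f \<in> AL" "d \<in> AL" "eval_at E a b d \<noteq> 0" "eval_at E a b f = 0"
      using gM by (rule max_ideal_affineE)
    then obtain r where "r \<in> ?R" "f = r * t" using gen by blast
    moreover have "inverse d \<in> ?R" using inv[of d] unit_AL[of d] fd by blast
    ultimately show ?thesis using fd(1) mult by (metis divide_inverse mult.assoc mult.commute)
  qed
  have unit_nz: "u \<noteq> 0" if "u \<in> ?R - ?M" for u
    using that max_ideal_AL[of 0] by auto
  have unit_mult: "u * v \<in> ?R - ?M" if "u \<in> ?R - ?M" "v \<in> ?R - ?M" for u v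
  proof -
    have "u * v \<notin> ?M"
    proof
      assume "u * v \<in> ?M"
      then have "inverse u * (u * v) \<in> ?M" using that inv ideal by blast
      then show False using that unit_nz[of u] by (simp add: field_simps)
    qed
    then show ?thesis using mult that by blast
  qed
  have unit_power: "u ^ i \<in> ?R - ?M" if "u \<in> ?R - ?M" for u i
    using that one unit_mult by (induction i) auto
  have unit_inverse: "inverse u \<in> ?R - ?M" if "u \<in> ?R - ?M" for u
    using that inv[of u] ideal[of u "inverse u"] one unit_nz[of u] by auto
  have split: "\<exists>n u. u \<in> ?R - ?M \<and> f = t ^ n * u"
    if "f \<in> ?R" "f' \<in> ?R" "f * f' = t ^ i * u" "u \<in> ?R - ?M" for f f' u i
    using that
  proof (induction i arbitrary: f)
    case 0
    then have "f \<notin> ?M" using ideal[of f' f] by (auto simp: mult.commute)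
    then show ?case using 0 by (intro exI[of _ 0] exI[of _ f]) simp
  next
    case (Suc i)
    show ?case
    proof (cases "f \<in> ?M")
      case True
      then obtain r where r: "r \<in> ?R" "f = r * t" using gens by blast
      then have "r * f' = t ^ i * u" using Suc.prems(3) t(3) by simp
      then obtain n v where "v \<in> ?R - ?M" "r = t ^ n * v" using Suc.IH r Suc.prems by blast
      then show ?thesis using r by (intro exI[of _ "Suc n"] exI[of _ v]) simp
    next
      case False
      then show ?thesis using Suc by (intro exI[of _ 0] exI[of _ f]) simp
    qed
  qed
  have factor_AL: "\<exists>n u. u \<in> ?R - ?M \<and> f = t ^ n * u" if f: "f \<in> AL" "f \<noteq> 0" for f
  proof -
    obtain f' d where f': "f' \<in> AL" "d \<noteq> 0" "f * f' = at_x d" using f by (rule norm_in_polys)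
    then obtain d' where d': "d = [:- a, 1:] ^ order a d * d'" "\<not> [:- a, 1:] dvd d'"
      using order_decomp by blast
    have at_x_power: "at_x (u ^ i) = at_x u ^ i" for u i by (induction i) simp_all
    have "at_x d = (x - k a) ^ order a d * at_x d'"
      by (subst d'(1)) (simp add: at_x_power)
    then have norm: "f * f' = t ^ (e * order a d) * (c ^ order a d * at_x d')"
      using f'(3) by (simp add: ram(1) power_mult power_mult_distrib mult_ac)
    have "at_x d' \<in> ?R - ?M"
      using d'(2) by (intro unit_AL) (simp_all add: at_x_elt poly_eq_0_iff_dvd)
    then have unit: "c ^ order a d * at_x d' \<in> ?R - ?M"
      by (rule unit_mult[OF unit_power[OF ram(2)]])
    show ?thesis
      by (rule split[OF local_ring_AL[OF f(1)] local_ring_AL[OF f'(1)] norm unit])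
  qed
  have factor: "\<exists>n u. u \<in> ?R - ?M \<and> g = t powi n * u" if "g \<noteq> 0" for g
  proof -
    obtain f d where g: "f \<in> AL" "d \<in> AL" "d \<noteq> 0" "g = f / d" by (rule fraction)
    with that have "f \<noteq> 0" by auto
    then obtain i u j v where "u \<in> ?R - ?M" "f = t ^ i * u" "v \<in> ?R - ?M" "d = t ^ j * v"
      using factor_AL g by meson
    moreover from this have "g = t powi (int i - int j) * (u * inverse v)"
      using t(3) g(4) unit_nz by (simp add: power_int_diff field_simps)
    ultimately show ?thesis using unit_mult unit_inverse by blast
  qed
  have "1 \<in> ?R" "1 \<notin> ?M" using one by blast+
  show ?thesis
    by (rule local_parameter.intro)
      (fact mult ideal M_sub \<open>1 \<in> ?R\<close> \<open>1 \<notin> ?M\<close> inv tM t(3) gens factor)+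
qed

lemma affine_local_parameter_exists:
  "\<exists>t. local_parameter (local_ring E (Affine a b)) (max_ideal E (Affine a b)) t"
proof -
  let ?R = "local_ring E (Affine a b)" and ?M = "max_ideal E (Affine a b)"
  have nz: "x - k a \<noteq> 0" "y - k b \<noteq> 0"
    by (simp_all only: x_elt y_elt emb_elt elt_diff elt_eq_0_iff) auto
  have unit_quot: "f / g \<in> ?R" if "f \<in> AL" "g \<in> AL" "eval_at E a b g \<noteq> 0" for f g
    using that by (rule local_ring_affineI)
  show ?thesis
  proof (cases "2 * b + a\<^sub>1 E * a + a\<^sub>3 E = 0")
    case False
    define y' where "y' = y - k (- b - a\<^sub>1 E * a - a\<^sub>3 E)"
    have y': "y' \<in> AL" "eval_at E a b y' \<noteq> 0"
      using False unfolding y'_def by (simp_all add: AL_intros algebra_simps del: emb_diff emb_minus)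
    then have "y' \<noteq> 0" by auto
    have "\<exists>r\<in>?R. f = r * (x - k a)" if "f \<in> AL" "eval_at E a b f = 0" for f
    proof -
      obtain g c where g: "g \<in> AL" "f = (x - k a) * g + k c * (y - k b)"
        using \<open>f \<in> AL\<close> \<open>eval_at E a b f = 0\<close> by (rule max_ideal_gens)
      have "f = (g * y' + k c * cofactor) / y' * (x - k a)"
      proof -
        have "(g * y' + k c * cofactor) * (x - k a) = g * (x - k a) * y' + k c * ((x - k a) * cofactor)"
          by (simp add: algebra_simps)
        also have "\<dots> = f * y'"
          unfolding g(2) cofactor_eq[symmetric] y'_def[symmetric] by (simp add: algebra_simps)
        finally show ?thesis using \<open>y' \<noteq> 0\<close> by simp
      qed
      moreover have "(g * y' + k c * cofactor) / y' \<in> ?R"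
        using g y' cofactor_AL by (intro unit_quot AL_intros)
      ultimately show ?thesis by blast
    qed
    then have "local_parameter ?R ?M (x - k a)"
      using nz unit_AL[of 1] by (intro affine_local_parameter[where e = 1 and c = 1]) (auto simp: AL_intros)
    then show ?thesis by blast
  next
    case True
    have b: "- b - a\<^sub>1 E * a - a\<^sub>3 E = b" using True by algebra
    have c: "eval_at E a b cofactor \<noteq> 0"
      using nonsingular[OF P True] eval_cofactor by simp
    then have c_unit: "cofactor \<in> ?R - ?M" and "cofactor \<noteq> 0"
      using unit_AL cofactor_AL by auto
    have sq: "(y - k b) * (y - k b) = (x - k a) * cofactor"
      using cofactor_eq unfolding b .
    have "\<exists>r\<in>?R. f = r * (y - k b)" if "f \<in> AL" "eval_at E a b f = 0" for f
    proof -
      obtain g c where g: "g \<in> AL" "f = (x - k a) * g + k c * (y - k b)"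
        using \<open>f \<in> AL\<close> \<open>eval_at E a b f = 0\<close> by (rule max_ideal_gens)
      have "f = ((y - k b) * g + k c * cofactor) / cofactor * (y - k b)"
      proof -
        have "((y - k b) * g + k c * cofactor) * (y - k b)
            = (y - k b) * (y - k b) * g + k c * cofactor * (y - k b)"
          by (simp add: algebra_simps)
        also have "\<dots> = f * cofactor"
          unfolding g(2) sq by (simp add: algebra_simps)
        finally show ?thesis using \<open>cofactor \<noteq> 0\<close> by simp
      qed
      moreover have "((y - k b) * g + k c * cofactor) / cofactor \<in> ?R"
        using g c cofactor_AL by (intro unit_quot AL_intros)
      ultimately show ?thesis by blast
    qed
    moreover have "inverse cofactor \<in> ?R - ?M"
    proof -
      have "inverse cofactor \<in> ?R"
        using unit_quot[of 1 cofactor] c cofactor_AL by (simp add: divide_inverse)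
      moreover have "inverse cofactor \<notin> ?M"
      proof
        assume "inverse cofactor \<in> ?M"
        then obtain f g where fg: "inverse cofactor = f / g" "f \<in> AL" "g \<in> AL"
          "eval_at E a b g \<noteq> 0" "eval_at E a b f = 0" by (rule max_ideal_affineE)
        then have "g = f * cofactor" using \<open>cofactor \<noteq> 0\<close> by (auto simp: field_simps)
        then show False using fg cofactor_AL by simp
      qed
      ultimately show ?thesis by blast
    qed
    ultimately have "local_parameter ?R ?M (y - k b)"
      using nz sq \<open>cofactor \<noteq> 0\<close>
      by (intro affine_local_parameter[where e = 2 and c = "inverse cofactor"])
        (auto simp: AL_intros power2_eq_square)
    then show ?thesis by blast
  qed
qed

end

lemma pole_deg_x: "pole_deg E x = 2" and pole_deg_y: "pole_deg E y = 3"
  by (simp_all only: x_elt y_elt) (simp_all add: pole_deg_def)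

lemma pole_deg_1: "pole_deg E 1 = 0"
proof -
  have "pole_deg E (k 1) = 0" by (simp only: emb_elt) (simp add: pole_deg_def)
  then show ?thesis by simp
qed

lemma x_nz: "x \<noteq> 0" and y_nz: "y \<noteq> 0"
  by (simp_all only: x_elt y_elt elt_eq_0_iff) auto

lemma pole_deg_power: "f \<in> AL \<Longrightarrow> f \<noteq> 0 \<Longrightarrow> pole_deg E (f ^ i) = i * pole_deg E f"
  by (induction i) (simp_all add: pole_deg_1 pole_deg_mult AL_power)

lemma infinity_local_parameter:
  "local_parameter (local_ring E Infinity) (max_ideal E Infinity) (x / y)"
proof -
  let ?R = "local_ring E Infinity" and ?M = "max_ideal E Infinity"
  have unit_quot: "f / g \<in> ?R - ?M"
    if "f \<in> AL" "g \<in> AL" "f \<noteq> 0" "g \<noteq> 0" "pole_deg E f = pole_deg E g" for f g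
  proof -
    have "f / g \<notin> ?M"
    proof
      assume "f / g \<in> ?M"
      then obtain f' g' where *: "f / g = f' / g'" "f' \<in> AL" "g' \<in> AL" "g' \<noteq> 0"
        "f' = 0 \<or> pole_deg E f' < pole_deg E g'" by (rule max_ideal_infinityE)
      then have eq: "f * g' = f' * g" and "f' \<noteq> 0" using that by (auto simp: frac_eq_eq)
      then have "pole_deg E f + pole_deg E g' = pole_deg E f' + pole_deg E g"
        using * that by (metis pole_deg_mult)
      then show False using * that \<open>f' \<noteq> 0\<close> by simp
    qed
    then show ?thesis using that local_ring_infinityI by simp
  qed
  have mult: "f * g \<in> ?R" if "f \<in> ?R" "g \<in> ?R" for f g
    using that by (elim local_ring_infinityE, rename_tac f1 f2 g1 g2, case_tac "f1 = 0 \<or> g1 = 0")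
      (auto simp: AL_mult pole_deg_mult intro!: local_ring_infinityI)
  have ideal: "f * g \<in> ?M" if "f \<in> ?R" "g \<in> ?M" for f g
    using that by (elim local_ring_infinityE max_ideal_infinityE, rename_tac f1 f2 g1 g2, case_tac "f1 = 0 \<or> g1 = 0")
      (auto simp: AL_mult pole_deg_mult intro!: max_ideal_infinityI)
  have M_sub: "?M \<subseteq> ?R"
    by (auto elim!: max_ideal_infinityE intro!: local_ring_infinityI)
  have one: "1 \<in> ?R - ?M" using unit_quot[of 1 1] by simp
  have inv: "inverse u \<in> ?R" if u: "u \<in> ?R" "u \<notin> ?M" for u
  proof -
    obtain f g where fg: "u = f / g" "f \<in> AL" "g \<in> AL" "g \<noteq> 0" "f = 0 \<or> pole_deg E f \<le> pole_deg E g"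
      using u(1) by (rule local_ring_infinityE)
    then have "f \<noteq> 0 \<and> \<not> pole_deg E f < pole_deg E g" using u(2) max_ideal_infinityI by blast
    then show ?thesis using unit_quot[of g f] fg by simp
  qed
  have tM: "x / y \<in> ?M"
    using pole_deg_x pole_deg_y y_nz by (intro max_ideal_infinityI) simp_all
  have gens: "\<exists>r\<in>?R. g = r * (x / y)" if gM: "g \<in> ?M" for g
  proof -
    obtain f d where fd: "g = f / d" "f \<in> AL" "d \<in> AL" "d \<noteq> 0" "f = 0 \<or> pole_deg E f < pole_deg E d"
      using gM by (rule max_ideal_infinityE)
    then have "f * y = 0 \<or> pole_deg E (f * y) \<le> pole_deg E (d * x)"
      using x_nz y_nz by (cases "f = 0") (auto simp: pole_deg_mult pole_deg_x pole_deg_y)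
    then have "(f * y) / (d * x) \<in> ?R"
      using fd x_nz by (intro local_ring_infinityI AL_intros) simp_all
    moreover have "g = (f * y) / (d * x) * (x / y)" using fd x_nz y_nz by simp
    ultimately show ?thesis by blast
  qed
  have factor: "\<exists>n u. u \<in> ?R - ?M \<and> g = (x / y) powi n * u" if "g \<noteq> 0" for g
  proof -
    obtain f d where g: "f \<in> AL" "d \<in> AL" "d \<noteq> 0" "g = f / d" by (rule fraction)
    with that have "f \<noteq> 0" by auto
    define i where "i = pole_deg E d"
    define j where "j = pole_deg E f"
    have "(f * x ^ j * y ^ i) / (d * x ^ i * y ^ j) \<in> ?R - ?M"
      using g \<open>f \<noteq> 0\<close> x_nz y_nz
      by (intro unit_quot) (simp_all add: AL_intros pole_deg_mult pole_deg_power pole_deg_x pole_deg_y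
          flip: i_def j_def)
    moreover have "g = (x / y) powi (int i - int j) * ((f * x ^ j * y ^ i) / (d * x ^ i * y ^ j))"
      using g x_nz y_nz by (simp add: power_int_diff field_simps)
    ultimately show ?thesis by blast
  qed
  have "x / y \<noteq> 0" using x_nz y_nz by simp
  have "1 \<in> ?R" "1 \<notin> ?M" using one by blast+
  show ?thesis
    by (rule local_parameter.intro)
      (fact mult ideal M_sub \<open>1 \<in> ?R\<close> \<open>1 \<notin> ?M\<close> inv tM \<open>x / y \<noteq> 0\<close> gens factor)+
qed

lemma local_parameter_exists:
  "on_curve E P \<Longrightarrow> \<exists>t. local_parameter (local_ring E P) (max_ideal E P) t"
  using affine_local_parameter_exists infinity_local_parameter by (cases P) blast+

lemma
  assumes "on_curve E P" "f \<noteq> 0"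
  shows ord_nonneg_iff: "0 \<le> ord_at E P f \<longleftrightarrow> f \<in> local_ring E P"
    and ord_pos_iff: "1 \<le> ord_at E P f \<longleftrightarrow> f \<in> max_ideal E P"
    and ord_mult: "g \<noteq> 0 \<Longrightarrow> ord_at E P (f * g) = ord_at E P f + ord_at E P g"
proof -
  obtain t where "local_parameter (local_ring E P) (max_ideal E P) t"
    using local_parameter_exists assms by blast
  then interpret local_parameter "local_ring E P" "max_ideal E P" t .
  have val: "ord_at E P g = val g" for g
    unfolding ord_at_def val_def uniformizer_def ..
  show "0 \<le> ord_at E P f \<longleftrightarrow> f \<in> local_ring E P" "1 \<le> ord_at E P f \<longleftrightarrow> f \<in> max_ideal E P"
    "g \<noteq> 0 \<Longrightarrow> ord_at E P (f * g) = ord_at E P f + ord_at E P g"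
    using assms val_nonneg_iff val_pos_iff val_mult unfolding val by blast+
qed

end

context elliptic_field
begin

section \<open>Functions determined by their divisors\<close>

lemma point_above: "\<exists>b. on_curve E (Affine a b)"
proof -
  have "\<exists>b. poly [:- poly cubic a, poly lin_part a, 1:] b = 0"
    by (rule alg_closed_imp_poly_has_root) simp
  then show ?thesis
    unfolding on_curve_iff by (auto simp: algebra_simps add_eq_0_iff2 intro!: exI)
qed

lemma on_curve_neg:
  "on_curve E (Affine a b) \<Longrightarrow> on_curve E (Affine a (- b - a\<^sub>1 E * a - a\<^sub>3 E))"
  by (simp add: algebra_simps power2_eq_square)

text \<open>A denominator in \<open>L[x]\<close> can be removed one linear factor \<open>x - a\<close> at a time: the
  numerator \<open>u + v y\<close> vanishes at both points above \<open>a\<close>, and if they coincide, then the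
  coefficient of \<open>y\<close> in \<open>s (u + v y)\<close>, where \<open>s\<close> does not vanish there, shows \<open>v(a) = 0\<close>.\<close>

lemma regular_imp_AL:
  assumes regular: "\<And>a b. on_curve E (Affine a b) \<Longrightarrow> g \<in> local_ring E (Affine a b)"
  shows "g \<in> AL"
proof -
  have clear: "g \<in> AL" if "d \<noteq> 0" "g * at_x d = elt E u v" for d u v
    using that
  proof (induction "degree d" arbitrary: d u v)
    case 0
    then obtain c where c: "d = [:c:]" "c \<noteq> 0" by (metis degree_eq_zeroE pCons_0_0)
    then have "g = k (inverse c) * elt E u v"
    proof -
      have "k c * k (inverse c) = 1" using c(2) by (simp flip: emb_mult)
      then show ?thesis using 0(3) c(1) by (simp add: mult.commute mult.left_commute flip: 0(3))
    qed
    then show ?case by (simp add: AL_mult)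
  next
    case (Suc i)
    then obtain a where "poly d a = 0" using alg_closed_imp_poly_has_root[of d] by auto
    then obtain d' where d: "d = [:- a, 1:] * d'" by (auto simp: poly_eq_0_iff_dvd)
    have key: "poly u a + poly v a * b = 0 \<and>
        (poly v a = 0 \<or> b \<noteq> - b - a\<^sub>1 E * a - a\<^sub>3 E)" if P: "on_curve E (Affine a b)" for b
    proof -
      obtain f s where fs: "g = f / s" "f \<in> AL" "s \<in> AL" "eval_at E a b s \<noteq> 0"
        using regular[OF P] by (rule local_ring_affineE)
      obtain f1 f2 where f: "f = elt E f1 f2" using fs(2) by (elim AL_cases)
      obtain s1 s2 where s: "s = elt E s1 s2" using fs(3) by (elim AL_cases)
      have "s \<noteq> 0" using fs(4) by auto
      then have "elt E u v * s = f * at_x d"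
        using Suc.prems(2)[symmetric] fs(1) by simp
      then have eq: "elt E (u * s1 + v * s2 * cubic) (u * s2 + s1 * v - v * s2 * lin_part)
          = elt E (f1 * d) (d * f2)"
        by (simp only: s f at_x_elt elt_mult) simp
      have "eval_at E a b (elt E u v) * eval_at E a b s = eval_at E a b f * eval_at E a b (at_x d)"
        using \<open>elt E u v * s = f * at_x d\<close> eval_mult[OF P] fs by (metis AL_elt AL_at_x)
      then have vanish: "poly u a + poly v a * b = 0"
        using fs(4) d by (simp add: at_x_elt)
      have "poly (u * s2 + s1 * v - v * s2 * lin_part) a = 0"
        using eq d by simp
      moreover have "poly u a = - poly v a * b" using vanish by (simp add: add_eq_0_iff2)
      ultimately have coeff_y: "poly v a * (poly s1 a + poly s2 a * (- b - a\<^sub>1 E * a - a\<^sub>3 E)) = 0"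
        by (simp add: lin_part_def algebra_simps)
      have "poly v a = 0" if "b = - b - a\<^sub>1 E * a - a\<^sub>3 E"
        using coeff_y fs(4) unfolding s eval_elt that[symmetric] by simp
      then show ?thesis using vanish by blast
    qed
    obtain b where b: "on_curve E (Affine a b)" using point_above by blast
    define b' where "b' = - b - a\<^sub>1 E * a - a\<^sub>3 E"
    have b': "on_curve E (Affine a b')" unfolding b'_def using b by (rule on_curve_neg)
    have "poly v a = 0"
    proof (cases "b = b'")
      case True
      then show ?thesis using key[OF b] unfolding b'_def by blast
    next
      case False
      have "poly v a * b = poly v a * b'" using key[OF b] key[OF b'] by (metis add_left_cancel)
      then show ?thesis using False by simp
    qed
    then have "poly u a = 0" using key[OF b] by simp
    then obtain u' v' where "u = [:- a, 1:] * u'" "v = [:- a, 1:] * v'"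
      using \<open>poly v a = 0\<close> by (metis poly_eq_0_iff_dvd dvdE)
    then have "at_x [:- a, 1:] * (g * at_x d') = at_x [:- a, 1:] * elt E u' v'"
      using Suc.prems(2) unfolding d elt_conv by (simp only: at_x_mult distrib_left ac_simps)
    moreover have "at_x [:- a, 1:] \<noteq> 0" by (simp only: at_x_elt elt_eq_0_iff) simp
    ultimately have "g * at_x d' = elt E u' v'" by simp
    moreover have "d' \<noteq> 0" using Suc.prems(1) unfolding d by auto
    moreover from this have "i = degree d'"
      using Suc.hyps(2) degree_mult_eq[of "[:- a, 1:]" d'] unfolding d by simp
    ultimately show ?case using Suc.hyps(1) by blast
  qed
  obtain f d where g: "f \<in> AL" "d \<in> AL" "d \<noteq> 0" "g = f / d" by (rule fraction)
  obtain d' e where d': "d' \<in> AL" "e \<noteq> 0" "d * d' = at_x e" using norm_in_polys g by metis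
  obtain u v where "f * d' = elt E u v" using AL_mult[OF g(1) d'(1)] by (rule AL_cases)
  then have "g * at_x e = elt E u v" using g by (simp flip: d'(3))
  then show ?thesis using clear d'(2) by blast
qed

lemma regular_at_infinity_imp_const:
  assumes "g \<in> AL" "g \<in> local_ring E Infinity"
  shows "\<exists>c. g = k c"
proof (cases "g = 0")
  case False
  obtain f d where fd: "g = f / d" "f \<in> AL" "d \<in> AL" "d \<noteq> 0" "f = 0 \<or> pole_deg E f \<le> pole_deg E d"
    using assms(2) by (rule local_ring_infinityE)
  then have "g * d = f" by simp
  then have "pole_deg E g + pole_deg E d \<le> pole_deg E d"
    using False fd assms(1) by (metis pole_deg_mult mult_eq_0_iff)
  then have deg: "pole_deg E g = 0" by simp
  obtain u v where g: "g = elt E u v" using assms(1) by (elim AL_cases)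
  then have "v = 0" "degree u = 0" using deg by (auto simp: pole_deg_def split: if_splits)
  then obtain c where "u = [:c:]" by (metis degree_eq_zeroE)
  then show ?thesis using g \<open>v = 0\<close> by (auto simp: emb_elt)
qed (auto intro: exI[of _ 0])

lemma has_divisor_ord: "has_divisor E g D \<Longrightarrow> on_curve E P \<Longrightarrow> ord_at E P g = Poly_Mapping.lookup D P"
  by (simp add: has_divisor_def)

lemma x_minus_nz: "x - k a \<noteq> 0"
  by (simp only: x_elt emb_elt elt_diff elt_eq_0_iff) auto

text \<open>The two points on the right may coincide. In that case the tangent there is vertical: \<open>x - a\<close> is a
  unit times \<open>(y - b)\<^sup>2\<close>.\<close>

lemma ord_x_minus:
  assumes V: "on_curve E (Affine a b)" and P: "on_curve E P"
  shows "ord_at E P (x - k a) \<ge> Poly_Mapping.lookup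
    (pt (Affine a b) + pt (Affine a (- b - a\<^sub>1 E * a - a\<^sub>3 E)) - Poly_Mapping.single Infinity 2) P"
proof (cases P)
  case Infinity
  have "x * x * (x - k a) / (y * y) \<in> local_ring E Infinity"
  proof (rule local_ring_infinityI)
    have "pole_deg E (x - k a) = 2"
      by (simp only: x_elt emb_elt elt_diff) (simp add: pole_deg_def)
    then show "x * x * (x - k a) = 0 \<or> pole_deg E (x * x * (x - k a)) \<le> pole_deg E (y * y)"
      using x_nz y_nz x_minus_nz
      by (simp add: pole_deg_mult AL_intros pole_deg_x pole_deg_y)
  qed (use y_nz in \<open>simp_all add: AL_intros\<close>)
  moreover define g where "g = x / y"
  then have g: "g \<noteq> 0" using x_nz y_nz by simp
  moreover have "x * x * (x - k a) / (y * y) = g * (g * (x - k a))" by (simp add: g_def)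
  ultimately have "0 \<le> ord_at E Infinity (g * (g * (x - k a)))"
    using ord_nonneg_iff[of Infinity "g * (g * (x - k a))"] x_minus_nz
    by (simp del: right_minus_eq)
  then have "0 \<le> 2 * ord_at E Infinity g + ord_at E Infinity (x - k a)"
    using g x_minus_nz by (simp add: ord_mult del: right_minus_eq)
  moreover have "ord_at E Infinity g = 1"
  proof -
    interpret local_parameter "local_ring E Infinity" "max_ideal E Infinity" "x / y"
      by (rule infinity_local_parameter)
    have "val (x / y) = 1" using val_eq[of 1 1] one by simp
    moreover have "ord_at E Infinity g = val g"
      unfolding ord_at_def val_def uniformizer_def ..
    ultimately show ?thesis by (simp add: g_def)
  qed
  ultimately show ?thesis
    using Infinity by (simp add: lookup_add lookup_minus lookup_single)
next
  case (Affine c d)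
  note P = P[unfolded Affine]
  define b' where "b' = - b - a\<^sub>1 E * a - a\<^sub>3 E"
  have nonneg: "0 \<le> ord_at E P (x - k a)"
    using ord_nonneg_iff[OF P] x_minus_nz local_ring_AL unfolding Affine by (simp add: AL_intros)
  have "1 \<le> ord_at E P (x - k a)" if "c = a"
    using ord_pos_iff[OF P] x_minus_nz max_ideal_AL that unfolding Affine by (simp add: AL_intros)
  moreover have "2 \<le> ord_at E P (x - k a)" if eq: "c = a" "d = b" "b = b'"
  proof -
    have two: "2 * b + a\<^sub>1 E * a + a\<^sub>3 E = 0" using eq(3) unfolding b'_def by algebra
    have sq: "(y - k b) * (y - k b) = (x - k a) * cofactor a"
      using cofactor_eq[OF V] unfolding b'_def[symmetric] eq(3)[symmetric] .
    have unit: "cofactor a \<in> local_ring E P - max_ideal E P"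
      using unit_AL[OF V cofactor_AL[OF V]] eval_cofactor[OF V] nonsingular[OF V two] eq
      unfolding Affine by simp
    have nz: "y - k b \<noteq> 0" "cofactor a \<noteq> 0"
      using sq x_minus_nz unit max_ideal_AL[of 0] by (auto simp: y_elt emb_elt elt_diff Affine)
    have oP: "on_curve E P" using P unfolding Affine .
    have "1 \<le> ord_at E P (y - k b)"
      using ord_pos_iff[OF P] nz max_ideal_AL eq unfolding Affine by (simp add: AL_intros)
    moreover have "ord_at E P (y - k b) + ord_at E P (y - k b)
        = ord_at E P (x - k a) + ord_at E P (cofactor a)"
      using arg_cong[OF sq, of "ord_at E P"] nz x_minus_nz by (simp add: ord_mult[OF oP])
    moreover have "ord_at E P (cofactor a) \<le> 0"
      using ord_pos_iff[OF oP nz(2)] unit by auto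
    ultimately show ?thesis by linarith
  qed
  ultimately show ?thesis
    using nonneg unfolding b'_def[symmetric] Affine by (auto simp: lookup_add lookup_minus lookup_single when_def)
qed

text \<open>The simple pole allowed at the point is cancelled by \<open>x - a\<close>, which also vanishes at the inverse
  point.\<close>

lemma inv_ideal_clear:
  assumes V: "on_curve E (Affine a b)" and g: "g \<in> inv_ideal E (pt (Affine a b))"
  shows "(x - k a) * g \<in> AL \<and> eval_at E a (- b - a\<^sub>1 E * a - a\<^sub>3 E) ((x - k a) * g) = 0"
proof (cases "g = 0")
  case False
  define b' where "b' = - b - a\<^sub>1 E * a - a\<^sub>3 E"
  have V': "on_curve E (Affine a b')" unfolding b'_def using V by (rule on_curve_neg)
  have nz: "(x - k a) * g \<noteq> 0" using False x_minus_nz by simp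
  obtain i :: nat where i: "g \<in> riemann_roch_space E
      (pt (Affine a b) + Poly_Mapping.single Infinity (int i))"
    using g unfolding inv_ideal_def by blast
  have ord: "ord_at E (Affine c d) ((x - k a) * g) \<ge> Poly_Mapping.lookup (pt (Affine a b')) (Affine c d)"
    if P: "on_curve E (Affine c d)" for c d
  proof -
    have "ord_at E (Affine c d) g + Poly_Mapping.lookup (pt (Affine a b)) (Affine c d) \<ge> 0"
      using i False P unfolding riemann_roch_space_def
      by (auto simp: lookup_add lookup_single simp del: on_curve.simps dest!: spec[of _ "Affine c d"])
    moreover have "ord_at E (Affine c d) (x - k a) \<ge>
        Poly_Mapping.lookup (pt (Affine a b)) (Affine c d) + Poly_Mapping.lookup (pt (Affine a b')) (Affine c d)"
      using ord_x_minus[OF V P] by (simp add: lookup_add lookup_minus lookup_single b'_def)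
    ultimately show ?thesis
      using ord_mult[OF P x_minus_nz False] by simp
  qed
  have AL: "(x - k a) * g \<in> AL"
  proof (rule regular_imp_AL)
    fix c d assume P: "on_curve E (Affine c d)"
    have "Poly_Mapping.lookup (pt (Affine a b')) (Affine c d) \<ge> (0::int)"
      by (simp add: lookup_single when_def)
    then show "(x - k a) * g \<in> local_ring E (Affine c d)"
      using ord[OF P] ord_nonneg_iff[OF P nz] by simp
  qed
  have "1 \<le> ord_at E (Affine a b') ((x - k a) * g)"
    using ord[OF V'] by simp
  then have "eval_at E a b' ((x - k a) * g) = 0"
    using ord_pos_iff[OF V' nz] max_ideal_eval[OF V' _ AL] by blast
  then show ?thesis using AL unfolding b'_def by blast
qed simp

lemma sign_x_minus: "sign_ring E (x - k a) = 1"
  by (simp only: x_elt emb_elt elt_diff) (simp add: sign_ring_def)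

lemma line_elt: "y - k s * x - k c = elt E [:- c, - s:] 1"
  by (simp add: elt_conv)

lemma sign_line: "sign_ring E (y - k s * x - k c) = 1"
  unfolding line_elt by (simp add: sign_ring_def)

text \<open>The quotient \<open>g\<close> of \<open>x - a\<close> by the product of \<open>h\<close> and the line has order at least zero everywhere,
  so it is a constant; comparison of signs shows that the constant is one. The intercept of the line
  is fixed by its zero at the inverse of \<open>(a, b)\<close>.\<close>

lemma h_times_line:
  assumes V: "on_curve E (Affine a b)"
    and h: "has_divisor E h (pt (Affine a b) + pt Infinity - pt V' - pt V'')" "sign E h = 1"
    and line: "line_slope E (neg_pt E (Affine a b)) V' V'' s"
  shows "h * (y - k (- b - a\<^sub>1 E * a - a\<^sub>3 E) - k s * (x - k a)) = x - k a"
proof -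
  define b' where "b' = - b - a\<^sub>1 E * a - a\<^sub>3 E"
  have neg: "neg_pt E (Affine a b) = Affine a b'" by (simp add: b'_def)
  have V': "on_curve E (Affine a b')" unfolding b'_def using V by (rule on_curve_neg)
  obtain c where "has_divisor E (y - k s * x - k c)
      (pt (Affine a b') + pt V' + pt V'' - Poly_Mapping.single Infinity 3)"
    using line unfolding line_slope_def neg by blast
  moreover define l where "l = y - k s * x - k c"
  ultimately have l: "has_divisor E l (pt (Affine a b') + pt V' + pt V'' - Poly_Mapping.single Infinity 3)"
    by simp
  have nz: "h \<noteq> 0" "l \<noteq> 0" using h(1) l by (auto simp: has_divisor_def)
  have hl: "ord_at E P (h * l) = Poly_Mapping.lookup
      (pt (Affine a b) + pt (Affine a b') - Poly_Mapping.single Infinity 2) P" if "on_curve E P" for P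
    using that nz has_divisor_ord[OF h(1)] has_divisor_ord[OF l]
    by (simp add: ord_mult lookup_add lookup_minus lookup_single when_def)
  define g where "g = (x - k a) / (h * l)"
  have g: "g \<noteq> 0" "x - k a = g * (h * l)" using nz x_minus_nz by (simp_all add: g_def)
  have regular: "g \<in> local_ring E P" if P: "on_curve E P" for P
  proof -
    have "ord_at E P (x - k a) = ord_at E P g + ord_at E P (h * l)"
      unfolding g(2) using g(1) nz by (intro ord_mult[OF P]) simp_all
    then have "0 \<le> ord_at E P g"
      using ord_x_minus[OF V P] hl[OF P] unfolding b'_def by simp
    then show ?thesis using ord_nonneg_iff[OF P g(1)] by simp
  qed
  have "g \<in> AL" using regular by (intro regular_imp_AL)
  then obtain d where d: "g = k d" using regular[of Infinity] regular_at_infinity_imp_const by auto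
  then have "d \<noteq> 0" using g(1) by auto
  have l_AL: "l \<in> AL" unfolding l_def by (intro AL_intros)
  have "h = (x - k a) / (k d * l)"
    using g d nz \<open>d \<noteq> 0\<close> by (simp add: field_simps)
  moreover have "sign_ring E (k d * l) = d"
  proof -
    have "sign_ring E (k d) = d" unfolding emb_elt by (simp add: sign_ring_def)
    then show ?thesis
      using l_AL nz(2) \<open>d \<noteq> 0\<close> by (simp add: sign_ring_mult sign_line l_def)
  qed
  ultimately have "sign E h = 1 / d"
    using x_minus_nz l_AL nz \<open>d \<noteq> 0\<close> by (simp add: sign_fraction AL_intros sign_x_minus)
  then have "d = 1" using h(2) by auto
  then have "x - k a = h * l" using g(2) d by simp
  moreover have "eval_at E a b' l = 0"
  proof -
    have "1 \<le> ord_at E (Affine a b') l"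
      using has_divisor_ord[OF l V'] by (simp add: lookup_add lookup_minus lookup_single when_def)
    then show ?thesis
      using ord_pos_iff[OF V' nz(2)] max_ideal_eval[OF V' _ l_AL] by blast
  qed
  then have c: "c = b' - s * a"
    unfolding l_def line_elt by (simp add: algebra_simps)
  have "l = y - k b' - k s * (x - k a)" unfolding l_def c by (simp add: algebra_simps)
  ultimately show ?thesis unfolding b'_def by simp
qed

section \<open>Identities between lines through the points\<close>

text \<open>The difference of the two sides is the difference of the curve equations at \<open>(X, Y)\<close> and \<open>(a, b)\<close>.\<close>

lemma chord_conjugate_identity:
  fixes X Y :: "'a::comm_ring_1"
  assumes "Y * Y = (a6 + X * (a4 + X * (a2 + X))) - (a3 + X * a1) * Y"
    and "b * b = (a6 + a * (a4 + a * (a2 + a))) - (a3 + a * a1) * b"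
    and b': "b' = - b - a1 * a - a3"
  shows "(Y - b' - s * (X - a)) * (Y + (s + a1) * (X - a) - b) =
    (X - a) * (X ^ 2 - (s ^ 2 + a1 * s - a2 - a) * X
      + (a4 - 2 * s * b' + s ^ 2 * a - a1 * b' - a3 * s + a2 * a + a ^ 2))"
    (is "?l = ?r")
proof -
  have "?l - ?r = (Y * Y - ((a6 + X * (a4 + X * (a2 + X))) - (a3 + X * a1) * Y))
      - (b * b - ((a6 + a * (a4 + a * (a2 + a))) - (a3 + a * a1) * b))"
    unfolding b' by (simp add: algebra_simps power2_eq_square)
  then show ?thesis using assms(1,2) by simp
qed

text \<open>After subtracting the curve equation at \<open>(X, Y)\<close> the difference of the two sides is linear in
  \<open>X\<close>, by the choice of \<open>t\<close>, and in \<open>Y\<close>; its coefficient at \<open>Y\<close> and its values at \<open>X = a\<close> and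
  \<open>X = c\<close> are combinations of the other three equations.\<close>

lemma twisted_chord_identity:
  fixes X Y :: "'a::idom"
  assumes "Y * Y = (a6 + X * (a4 + X * (a2 + X))) - (a3 + X * a1) * Y"
    and "b * b = (a6 + a * (a4 + a * (a2 + a))) - (a3 + a * a1) * b"
    and "d * d = (a6 + c * (a4 + c * (a2 + c))) - (a3 + c * a1) * d"
    and "m * (c - a) = d - b'" and "c \<noteq> a"
    and b': "b' = - b - a1 * a - a3" and d': "d' = - d - a1 * c - a3"
    and t: "t = m ^ 2 + a1 * m - a2 - a - c"
  shows "(Y - b' - m * (X - a)) * (Y - d' - r * (X - c)) =
    (X - c) * ((X + ((r + m + a1) * (m - s) - t)) * (X - a)
      + (- r - m - a1) * (Y - b' - s * (X - a)))" (is "?l = ?r")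
proof -
  define P where "P = Y * Y - ((a6 + X * (a4 + X * (a2 + X))) - (a3 + X * a1) * Y)"
  define Q where "Q = b * b - ((a6 + a * (a4 + a * (a2 + a))) - (a3 + a * a1) * b)"
  define R where "R = d * d - ((a6 + c * (a4 + c * (a2 + c))) - (a3 + c * a1) * d)"
  define S where "S = m * (c - a) - (d - b')"
  have "(c - a) * (?l - ?r) = (c - a) * (P - S * Y) + (d' * S - R) * (X - a) - (b' * S - Q) * (X - c)"
    unfolding P_def Q_def R_def S_def b' d' t by (simp add: algebra_simps power2_eq_square)
  also have "\<dots> = 0"
    using assms by (simp add: P_def Q_def R_def S_def)
  finally show ?thesis using \<open>c \<noteq> a\<close> by simp
qed

lemma line_product:
  assumes V: "on_curve E (Affine a b)" and b': "b' = - b - a\<^sub>1 E * a - a\<^sub>3 E"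
  shows "(y - k b' - k s * (x - k a)) * (y + k (s + a\<^sub>1 E) * (x - k a) - k b) =
    (x - k a) * (x ^ 2 - k (s ^ 2 + a\<^sub>1 E * s - a\<^sub>2 E - a) * x
      + k (a\<^sub>4 E - 2 * s * b' + s ^ 2 * a - a\<^sub>1 E * b' - a\<^sub>3 E * s + a\<^sub>2 E * a + a ^ 2))"
proof -
  have "k b * k b = k (poly cubic a - poly lin_part a * b)"
    using V unfolding on_curve_iff by (metis emb_mult)
  then show ?thesis
    using y_square unfolding b'
    by (simp add: cubic_def lin_part_def del: mult_eq_0_iff)
      (rule chord_conjugate_identity[OF _ _ refl])
qed

text \<open>The left side is the product of a line through \<open>(a, b)\<^sup>\<or>\<close> and \<open>(aq, bq)\<close> with a line through
  \<open>(aq, bq)\<^sup>\<or>\<close>, so it is divisible by \<open>x - aq\<close>. The quotient has pole order four and vanishes at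
  \<open>(a, b)\<^sup>\<or>\<close>; such functions are spanned by \<open>x (x - a)\<close>, \<open>x - a\<close> and the line of slope \<open>s\<close> through
  \<open>(a, b)\<^sup>\<or>\<close>.\<close>

lemma twisted_line_product:
  assumes V: "on_curve E (Affine a b)" and b': "b' = - b - a\<^sub>1 E * a - a\<^sub>3 E"
    and W: "on_curve E (Affine aq bq)" and bq': "bq' = - bq - a\<^sub>1 E * aq - a\<^sub>3 E"
    and ne: "aq \<noteq> a"
    and m: "m * (aq - a) = bq - b'" and t: "t = m ^ 2 + a\<^sub>1 E * m - a\<^sub>2 E - a - aq"
  shows "(y - k b' - k m * (x - k a)) * (y - k bq' - k sq * (x - k aq)) =
    (x - k aq) * ((x + k ((sq + m + a\<^sub>1 E) * (m - s) - t)) * (x - k a)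
      + k (- sq - m - a\<^sub>1 E) * (y - k b' - k s * (x - k a)))"
proof -
  have 1: "k b * k b = k (poly cubic a - poly lin_part a * b)"
    using V unfolding on_curve_iff by (metis emb_mult)
  have 2: "k bq * k bq = k (poly cubic aq - poly lin_part aq * bq)"
    using W unfolding on_curve_iff by (metis emb_mult)
  have 3: "k m * (k aq - k a) = k bq - k b'"
    using m by (metis emb_mult emb_diff)
  have "k aq \<noteq> k a" using ne by simp
  then show ?thesis
    using y_square 1 2 3 unfolding b' bq' t
    by (simp add: cubic_def lin_part_def del: mult_eq_0_iff)
      (rule twisted_chord_identity[OF _ _ _ _ _ refl refl refl], assumption+, simp)
qed

end

section \<open>The Frobenius twist\<close>

locale frobenius_field = elliptic_field E for E :: "('l::alg_closed_field, 'f::field) curve" +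
  fixes q :: nat
  assumes q: "q > 1" and frob_add: "\<And>c d :: 'l. (c + d) ^ q = c ^ q + d ^ q"
    and coeffs_Fq: "{a\<^sub>1 E, a\<^sub>2 E, a\<^sub>3 E, a\<^sub>4 E, a\<^sub>6 E} \<subseteq> Fq q"
begin

lemma frob_coeffs [simp]:
  "a\<^sub>1 E ^ q = a\<^sub>1 E" "a\<^sub>2 E ^ q = a\<^sub>2 E" "a\<^sub>3 E ^ q = a\<^sub>3 E" "a\<^sub>4 E ^ q = a\<^sub>4 E" "a\<^sub>6 E ^ q = a\<^sub>6 E"
  using coeffs_Fq by (auto simp: Fq_def)

lemma frob_0 [simp]: "(0::'l) ^ q = 0"
  using q by (simp add: power_0_left)

lemma frob_minus: "(- c) ^ q = - (c ^ q)" for c :: 'l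
  using frob_add[of c "- c"] by (simp add: eq_neg_iff_add_eq_0 add.commute)

lemma frob_diff: "(c - d) ^ q = c ^ q - d ^ q" for c d :: 'l
  using frob_add[of c "- d"] by (simp add: frob_minus)

lemma frob_numeral: "(numeral i :: 'l) ^ q = numeral i"
proof -
  have "(of_nat j :: 'l) ^ q = of_nat j" for j :: nat
    by (induction j) (simp_all add: frob_add)
  then show ?thesis by (metis of_nat_numeral)
qed

lemma frob_commute: "(c ^ numeral i) ^ q = (c ^ q) ^ numeral i" for c :: 'l
  by (simp add: mult.commute flip: power_mult)

lemmas frob_simps = frob_add frob_diff frob_minus frob_numeral frob_commute power_mult_distrib
  power_divide

lemma on_curve_frob:
  assumes "on_curve E (Affine a b)"
  shows "on_curve E (Affine (a ^ q) (b ^ q))"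
proof -
  have "(b ^ 2 + a\<^sub>1 E * a * b + a\<^sub>3 E * b) ^ q = (a ^ 3 + a\<^sub>2 E * a ^ 2 + a\<^sub>4 E * a + a\<^sub>6 E) ^ q"
    using assms by (simp only: on_curve.simps)
  then show ?thesis by (simp add: frob_simps)
qed

abbreviation frob_poly :: "'l poly \<Rightarrow> 'l poly" where
  "frob_poly \<equiv> map_poly (\<lambda>c. c ^ q)"

lemma frob_poly_add: "frob_poly (u + v) = frob_poly u + frob_poly v"
  by (rule map_poly_hom_add) (simp_all add: frob_add)

lemma frob_poly_mult: "frob_poly (u * v) = frob_poly u * frob_poly v"
  by (rule map_poly_hom_mult) (simp_all add: frob_add power_mult_distrib)

lemma frob_poly_diff: "frob_poly (u - v) = frob_poly u - frob_poly v"
  by (intro poly_eqI) (simp add: coeff_map_poly frob_diff)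

lemma frob_poly_curve: "frob_poly cubic = cubic" "frob_poly lin_part = lin_part"
  by (simp_all add: cubic_def lin_part_def map_poly_pCons)

lemma frob_poly_eq_0: "frob_poly u = 0 \<longleftrightarrow> u = 0"
  by (rule map_poly_eq_0_iff) (use q in auto)

lemma twist_ring_elt: "twist_ring q E (elt E u v) = elt E (frob_poly u) (frob_poly v)"
  by (simp add: twist_ring_def)

lemma twist_ring_mult:
  "f \<in> AL \<Longrightarrow> g \<in> AL \<Longrightarrow> twist_ring q E (f * g) = twist_ring q E f * twist_ring q E g"
  by (elim AL_cases)
    (simp add: elt_mult twist_ring_elt frob_poly_add frob_poly_mult frob_poly_diff frob_poly_curve)

lemma twist_ring_nz: "f \<in> AL \<Longrightarrow> f \<noteq> 0 \<Longrightarrow> twist_ring q E f \<noteq> 0"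
  by (elim AL_cases) (auto simp: twist_ring_elt frob_poly_eq_0)

lemma twist_fraction:
  assumes "f \<in> AL" "g \<in> AL" "g \<noteq> 0"
  shows "twist q E (f / g) = twist_ring q E f / twist_ring q E g"
  unfolding twist_def
proof (rule the_equality)
  show "\<exists>a\<in>AL. \<exists>b\<in>AL. b \<noteq> 0 \<and> f / g = a / b \<and>
      twist_ring q E f / twist_ring q E g = twist_ring q E a / twist_ring q E b"
    using assms by blast
next
  fix z
  assume "\<exists>a\<in>AL. \<exists>b\<in>AL. b \<noteq> 0 \<and> f / g = a / b \<and> z = twist_ring q E a / twist_ring q E b"
  then obtain a b where ab: "a \<in> AL" "b \<in> AL" "b \<noteq> 0" "f / g = a / b"
    and z: "z = twist_ring q E a / twist_ring q E b" by blast
  then have "f * b = a * g" using assms by (simp add: frac_eq_eq)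
  then have "twist_ring q E f * twist_ring q E b = twist_ring q E a * twist_ring q E g"
    using ab assms by (metis twist_ring_mult)
  then show "z = twist_ring q E f / twist_ring q E g"
    using ab assms by (simp add: z twist_ring_nz frac_eq_eq)
qed

lemma twist_ring_x_minus: "twist_ring q E (x - k a) = x - k (a ^ q)"
proof -
  have x: "x - k c = elt E [:- c, 1:] 0" for c by (simp add: elt_conv)
  show ?thesis unfolding x twist_ring_elt by (simp add: map_poly_pCons frob_minus)
qed

lemma twist_ring_line:
  "twist_ring q E (y - k b - k s * (x - k a)) = y - k (b ^ q) - k (s ^ q) * (x - k (a ^ q))"
proof -
  have line: "y - k b - k s * (x - k a) = elt E [:s * a - b, - s:] 1" for a b s
    by (simp add: elt_conv algebra_simps)
  show ?thesis
    unfolding line twist_ring_elt by (simp add: map_poly_pCons frob_simps)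
qed

text \<open>If \<open>a\<close> were fixed by the Frobenius, then \<open>b ^ q\<close> would be \<open>b\<close> or its conjugate. In the first case the
  sum of the points is the point at infinity. In the second case \<open>(a, b)\<close>, hence also \<open>(t, e)\<close>, has
  coordinates fixed by the \<open>q\<^sup>2\<close>-power map, so that \<open>X^(q\<^sup>2) - X\<close> vanishes at \<open>t\<close>.\<close>

lemma frob_moves_point:
  assumes V: "on_curve E (Affine a b)"
    and add: "add_pt E (Affine a b) (neg_pt E (frob_pt q (Affine a b))) = Affine t e"
    and generic: "generic_point q E t e"
  shows "a ^ q \<noteq> a"
proof
  assume a: "a ^ q = a"
  define b' where "b' = - b - a\<^sub>1 E * a - a\<^sub>3 E"
  have "b ^ q \<noteq> b" using add a by auto
  have "(b ^ q - b) * (b ^ q - b') = 0"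
  proof -
    have "(B - b) * (B - b') = (B ^ 2 + a\<^sub>1 E * a * B + a\<^sub>3 E * B)
        - (b ^ 2 + a\<^sub>1 E * a * b + a\<^sub>3 E * b)" for B
      unfolding b'_def by (simp add: algebra_simps power2_eq_square)
    then show ?thesis using V on_curve_frob[OF V] unfolding a on_curve.simps by simp
  qed
  then have bq: "b ^ q = b'" using \<open>b ^ q \<noteq> b\<close> by simp
  then have b'q: "b' ^ q = b" by (simp add: b'_def frob_simps a)
  define s where "s = (3 * a ^ 2 + 2 * a\<^sub>2 E * a + a\<^sub>4 E - a\<^sub>1 E * b) / (2 * b + a\<^sub>1 E * a + a\<^sub>3 E)"
  have t: "t = s ^ 2 + a\<^sub>1 E * s - a\<^sub>2 E - a - a"
    using add \<open>b ^ q \<noteq> b\<close> unfolding s_def by (simp add: a bq Let_def b'_def split: if_splits)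
  have "(s ^ q) ^ q = s"
    unfolding s_def by (simp add: frob_simps a bq b'q)
  then have "(t ^ q) ^ q = t"
    unfolding t by (simp add: frob_simps a)
  then have root: "poly (monom 1 (q * q) - monom 1 1) t + poly 0 t * e = 0"
    by (simp add: poly_monom power_mult)
  have nz: "monom (1::'l) (q * q) - monom 1 1 \<noteq> 0"
    using q by (metis One_nat_def degree_monom_eq less_1_mult nat_neq_iff right_minus_eq zero_neq_one)
  have Fq: "poly.coeff (monom (1::'l) (q * q) - monom 1 1) i \<in> Fq q" for i
    using q frob_minus[of 1] by (auto simp: Fq_def)
  have "poly.coeff (0::'l poly) i \<in> Fq q" for i :: nat
    using q by (simp add: Fq_def)
  with generic root Fq have "monom (1::'l) (q * q) - monom 1 1 = 0"
    unfolding generic_point_def by blast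
  with nz show False by simp
qed

text \<open>The addition law uses the chord through \<open>(a, b)\<close> and the inverse of its Frobenius image, of slope
  \<open>- m - a\<^sub>1\<close>. The line of slope \<open>m\<close> is the conjugate of this chord; it passes through \<open>(t, e)\<close> and the
  inverse of \<open>(a, b)\<close>.\<close>

lemma generic_point_on_line:
  assumes add: "add_pt E (Affine a b) (neg_pt E (frob_pt q (Affine a b))) = Affine t e"
    and ne: "a ^ q \<noteq> a" and b': "b' = - b - a\<^sub>1 E * a - a\<^sub>3 E"
    and m: "m = (b ^ q - b') / (a ^ q - a)"
  shows "t = m ^ 2 + a\<^sub>1 E * m - a\<^sub>2 E - a - a ^ q" "e - m * t = b' - m * a"
proof -
  define s where "s = (- (b ^ q) - a\<^sub>1 E * a ^ q - a\<^sub>3 E - b) / (a ^ q - a)"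
  have "m * (a ^ q - a) = b ^ q - b'" "s * (a ^ q - a) = - (b ^ q) - a\<^sub>1 E * a ^ q - a\<^sub>3 E - b"
    using ne by (simp_all add: m s_def)
  then have "(s + m + a\<^sub>1 E) * (a ^ q - a) = 0" 
    unfolding b' by (simp add: distrib_right) (simp add: algebra_simps)
  then have "s + m + a\<^sub>1 E = 0" using ne by simp
  then have s: "s = - m - a\<^sub>1 E" by algebra
  have te: "t = s ^ 2 + a\<^sub>1 E * s - a\<^sub>2 E - a - a ^ q \<and> e = - (s + a\<^sub>1 E) * t - (b - s * a) - a\<^sub>3 E"
    using add ne by (auto simp: Let_def s_def)
  then show "t = m ^ 2 + a\<^sub>1 E * m - a\<^sub>2 E - a - a ^ q"
    unfolding s by (simp add: algebra_simps power2_eq_square)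
  show "e - m * t = b' - m * a"
    using te unfolding s b' by (simp add: algebra_simps)
qed

end

section \<open>The motive\<close>

text \<open>Elimination of the coefficient \<open>N\<close> reduces \<open>N + 1\<close> to \<open>N\<close>, at the cost of one polynomial.\<close>

lemma polys_of_small_degree_dependent:
  fixes f :: "'i \<Rightarrow> 'l::field poly"
  assumes "finite I" "card I > N" "\<And>i j. i \<in> I \<Longrightarrow> j \<ge> N \<Longrightarrow> poly.coeff (f i) j = 0"
  shows "\<exists>c. (\<exists>i\<in>I. c i \<noteq> 0) \<and> (\<Sum>i\<in>I. smult (c i) (f i)) = 0"
  using assms
proof (induction N arbitrary: I f)
  case 0
  then have "f i = 0" if "i \<in> I" for i using that by (intro poly_eqI) simp
  moreover have "I \<noteq> {}" using 0 by auto
  ultimately show ?case by (intro exI[of _ "\<lambda>_. 1"]) auto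
next
  case (Suc N)
  show ?case
  proof (cases "\<forall>i\<in>I. poly.coeff (f i) N = 0")
    case True
    have "poly.coeff (f i) j = 0" if "i \<in> I" "j \<ge> N" for i j
      using Suc.prems(3)[of i j] True that by (cases "j = N") auto
    then show ?thesis using Suc.IH[of I f] Suc.prems by simp
  next
    case False
    then obtain l where l: "l \<in> I" "poly.coeff (f l) N \<noteq> 0" by blast
    define r where "r i = poly.coeff (f i) N / poly.coeff (f l) N" for i
    define J where "J = I - {l}"
    have J: "finite J" "l \<notin> J" "I = insert l J" using Suc.prems l by (auto simp: J_def)
    have "poly.coeff (f i - smult (r i) (f l)) j = 0" if "i \<in> J" "j \<ge> N" for i j
      using Suc.prems(3)[of i j] Suc.prems(3)[of l j] that l J by (cases "j = N") (auto simp: r_def)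
    then obtain c where c: "\<exists>i\<in>J. c i \<noteq> 0" "(\<Sum>i\<in>J. smult (c i) (f i - smult (r i) (f l))) = 0"
      using Suc.IH[of J "\<lambda>i. f i - smult (r i) (f l)"] Suc.prems J by auto
    define c' where "c' = c(l := - (\<Sum>i\<in>J. c i * r i))"
    have "(\<Sum>i\<in>I. smult (c' i) (f i)) = smult (c' l) (f l) + (\<Sum>i\<in>J. smult (c i) (f i))"
      using J by (auto simp: c'_def intro!: sum.cong)
    also have "\<dots> = (\<Sum>i\<in>J. smult (c i) (f i - smult (r i) (f l)))"
      by (simp add: c'_def smult_diff_right sum_subtractf smult_sum sum_negf)
    also have "\<dots> = 0" by (rule c(2))
    finally show ?thesis using c(1) J by (intro exI[of _ c']) (auto simp: c'_def)
  qed
qed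

lemma tmul_degree:
  fixes f g :: "'l::field poly"
  assumes "f \<noteq> 0" "g \<noteq> 0"
  shows "tmul q f g \<noteq> 0 \<and> degree (tmul q f g) = degree f + degree g"
proof -
  let ?d = "degree f + degree g"
  have "poly.coeff (tmul q f g) ?d =
      (\<Sum>i\<le>degree f. \<Sum>j\<le>degree g. if i + j = ?d then poly.coeff f i * poly.coeff g j ^ (q ^ i) else 0)"
    by (simp add: tmul_def coeff_sum)
  also have "\<dots> = (\<Sum>i\<le>degree f. \<Sum>j\<le>degree g. if i = degree f \<and> j = degree g
      then poly.coeff f i * poly.coeff g j ^ (q ^ i) else 0)"
    by (intro sum.cong refl if_cong) auto
  also have "\<dots> = (\<Sum>i\<le>degree f. if i = degree f then poly.coeff f i * lead_coeff g ^ (q ^ i) else 0)"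
    by (intro sum.cong refl) (simp add: sum.delta)
  also have "\<dots> = lead_coeff f * lead_coeff g ^ (q ^ degree f)"
    by (simp add: sum.delta)
  finally have lead: "poly.coeff (tmul q f g) ?d \<noteq> 0" using assms by simp
  have "degree (tmul q f g) \<le> ?d"
    unfolding tmul_def
    by (intro degree_sum_le) (auto intro!: degree_sum_le order_trans[OF degree_monom_le])
  then show ?thesis using lead le_degree[OF lead] by auto
qed

text \<open>The degrees of the \<open>p i\<close> differ, so the last term dominates.\<close>

lemma graded_sum_degree:
  fixes p :: "nat \<Rightarrow> 'l::field poly"
  assumes p: "\<And>i. p i \<noteq> 0 \<and> degree (p i) = d + 4 * i" and "u \<noteq> 0"
  defines "S \<equiv> \<Sum>i\<le>degree u. smult (poly.coeff u i) (p i)"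
  shows "S \<noteq> 0 \<and> degree S = d + 4 * degree u"
proof -
  let ?n = "degree u"
  have "poly.coeff S (d + 4 * ?n) = (\<Sum>i\<le>?n. if i = ?n then poly.coeff u i * lead_coeff (p i) else 0)"
    unfolding S_def coeff_sum using p by (intro sum.cong) (auto intro!: coeff_eq_0)
  also have "\<dots> = lead_coeff u * lead_coeff (p ?n)" by simp
  finally have lead: "poly.coeff S (d + 4 * ?n) \<noteq> 0"
    using p[of ?n] assms(2) by (metis leading_coeff_0_iff mult_eq_0_iff)
  have "degree S \<le> d + 4 * ?n"
    unfolding S_def using p by (intro degree_sum_le) (auto intro: order_trans[OF degree_smult_le])
  then show ?thesis using lead le_degree[OF lead] by auto
qed

locale drinfeld_module = frobenius_field E q for E :: "('l::alg_closed_field, 'f::field) curve" and q +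
  fixes \<phi> :: "'f \<Rightarrow> 'l poly" and \<theta> \<eta> :: 'l
  assumes drinfeld: "sgn_drinfeld_rank2 q E \<theta> \<eta> \<phi>"
begin

abbreviation act :: "'f \<Rightarrow> 'l poly \<Rightarrow> 'l poly" where
  "act \<equiv> motive_act q E \<phi>"

lemma x_power_elt: "x ^ i = elt E (monom 1 i) 0"
proof -
  have "at_x (monom 1 i) = x ^ i"
    by (induction i) (simp_all add: monom_Suc flip: one_pCons)
  then show ?thesis by (simp add: elt_conv)
qed

lemma x_power_y_elt: "x ^ i * y = elt E 0 (monom 1 i)"
  using x_power_elt[of i] by (simp add: elt_conv)

lemma coord_ring_basis: "x ^ i \<in> coord_ring q E" "x ^ i * y \<in> coord_ring q E"
proof -
  have "poly.coeff (monom (1::'l) i) j \<in> Fq q" "poly.coeff (0::'l poly) j \<in> Fq q" for j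
    using q by (simp_all add: Fq_def)
  then show "x ^ i \<in> coord_ring q E" "x ^ i * y \<in> coord_ring q E"
    unfolding coord_ring_def x_power_y_elt unfolding x_power_elt by blast+
qed

lemma phi_mult: "a \<in> coord_ring q E \<Longrightarrow> b \<in> coord_ring q E \<Longrightarrow> \<phi> (a * b) = tmul q (\<phi> a) (\<phi> b)"
  using drinfeld unfolding sgn_drinfeld_rank2_def by blast

lemma phi_x_power: "\<phi> (x ^ i) \<noteq> 0 \<and> degree (\<phi> (x ^ i)) = 4 * i"
proof (induction i)
  case 0
  have "(1::'l) \<in> Fq q" by (simp add: Fq_def)
  then have "\<phi> (k 1) = [:1:]"
    using drinfeld unfolding sgn_drinfeld_rank2_def by blast
  then show ?case by simp
next
  case (Suc i)
  obtain g1 g2 g3 where "\<phi> x = [:\<theta>, g1, g2, g3, 1:]"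
    using drinfeld unfolding sgn_drinfeld_rank2_def by blast
  then have "\<phi> x \<noteq> 0" "degree (\<phi> x) = 4" by simp_all
  moreover have "\<phi> (x ^ Suc i) = tmul q (\<phi> x) (\<phi> (x ^ i))"
    using phi_mult[of x "x ^ i"] coord_ring_basis(1)[of 1] coord_ring_basis(1)[of i] by simp
  ultimately show ?case using tmul_degree[of "\<phi> x" "\<phi> (x ^ i)" q] Suc by simp
qed

lemma phi_x_power_y: "\<phi> (x ^ i * y) \<noteq> 0 \<and> degree (\<phi> (x ^ i * y)) = 4 * i + 6"
proof -
  obtain h1 h2 h3 h4 h5 where "\<phi> y = [:\<eta>, h1, h2, h3, h4, h5, 1:]"
    using drinfeld unfolding sgn_drinfeld_rank2_def by blast
  then have "\<phi> y \<noteq> 0" "degree (\<phi> y) = 6" by simp_all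
  moreover have "\<phi> (x ^ i * y) = tmul q (\<phi> (x ^ i)) (\<phi> y)"
    using phi_mult[of "x ^ i" y] coord_ring_basis(2)[of 0] coord_ring_basis(1)[of i] by simp
  ultimately show ?thesis using tmul_degree[of "\<phi> (x ^ i)" "\<phi> y" q] phi_x_power[of i] by simp
qed

text \<open>The rank of the motive is two: multiplication by a function of pole order \<open>d\<close> raises the
  degree in \<open>\<tau>\<close> by \<open>2 d\<close>.  The summands for \<open>u(x)\<close> and \<open>v(x) y\<close> have degrees of different residue
  modulo four, so they cannot cancel.\<close>

lemma act_degree:
  assumes g: "g \<in> AL" "g \<noteq> 0" and "\<omega> \<noteq> 0"
  shows "act g \<omega> \<noteq> 0 \<and> degree (act g \<omega>) = degree \<omega> + 2 * pole_deg E g"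
proof -
  obtain u v where g': "g = elt E u v" using g by (elim AL_cases)
  define S where "S = (\<Sum>i\<le>degree u. smult (poly.coeff u i) (tmul q \<omega> (\<phi> (x ^ i))))"
  define T where "T = (\<Sum>i\<le>degree v. smult (poly.coeff v i) (tmul q \<omega> (\<phi> (x ^ i * y))))"
  have act: "act g \<omega> = S + T" by (simp add: motive_act_def g' S_def T_def)
  have "tmul q \<omega> (\<phi> (x ^ i)) \<noteq> 0 \<and> degree (tmul q \<omega> (\<phi> (x ^ i))) = degree \<omega> + 4 * i"
    "tmul q \<omega> (\<phi> (x ^ i * y)) \<noteq> 0 \<and> degree (tmul q \<omega> (\<phi> (x ^ i * y))) = degree \<omega> + 6 + 4 * i" for i
    using tmul_degree[OF \<open>\<omega> \<noteq> 0\<close>, of _ q] phi_x_power[of i] phi_x_power_y[of i] by auto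
  note graded = this
  have S: "S \<noteq> 0 \<and> degree S = degree \<omega> + 4 * degree u" if "u \<noteq> 0"
    unfolding S_def by (rule graded_sum_degree[OF graded(1) that])
  have T: "T \<noteq> 0 \<and> degree T = degree \<omega> + 6 + 4 * degree v" if "v \<noteq> 0"
    unfolding T_def by (rule graded_sum_degree[OF graded(2) that])
  have S0: "S = 0" if "u = 0" using that by (simp add: S_def)
  have T0: "T = 0" if "v = 0" using that by (simp add: T_def)
  show ?thesis
  proof (cases "u = 0 \<or> v = 0")
    case True
    then show ?thesis
      using S T S0 T0 g(2) unfolding act by (auto simp: g' pole_deg_def)
  next
    case False
    have "4 * degree u \<noteq> 6 + 4 * degree v" by presburger
    then consider "degree S < degree T" | "degree T < degree S"
      using S T False by (metis add.assoc add_left_cancel linorder_neqE_nat)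
    then show ?thesis
    proof cases
      case 1
      then have "S + T \<noteq> 0" "degree (S + T) = degree T"
        by (auto simp: degree_add_eq_right add_eq_0_iff)
      then show ?thesis using 1 S T False unfolding act by (auto simp: g' pole_deg_def)
    next
      case 2
      then have "S + T \<noteq> 0" "degree (S + T) = degree S"
        by (auto simp: degree_add_eq_left add_eq_0_iff)
      then show ?thesis using 2 S T False unfolding act by (auto simp: g' pole_deg_def)
    qed
  qed
qed

lemma act_extend:
  assumes "degree u < N" "degree v < N"
  shows "act (elt E u v) \<omega> = (\<Sum>i<N. smult (poly.coeff u i) (tmul q \<omega> (\<phi> (x ^ i)))) +
    (\<Sum>i<N. smult (poly.coeff v i) (tmul q \<omega> (\<phi> (x ^ i * y))))"
proof -
  have "(\<Sum>i\<le>degree w. smult (poly.coeff w i) (f i)) = (\<Sum>i<N. smult (poly.coeff w i) (f i))"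
    if "degree w < N" for w :: "'l poly" and f :: "nat \<Rightarrow> 'l poly"
    using that by (intro sum.mono_neutral_left) (auto intro: coeff_eq_0)
  then show ?thesis using assms by (simp add: motive_act_def)
qed

lemma act_add: "f \<in> AL \<Longrightarrow> g \<in> AL \<Longrightarrow> act (f + g) \<omega> = act f \<omega> + act g \<omega>"
proof (elim AL_cases)
  fix u v u' v' assume fg: "f = elt E u v" "g = elt E u' v'"
  define N where "N = Suc (max (max (degree u) (degree v)) (max (degree u') (degree v')))"
  have less: "degree u < N" "degree v < N" "degree u' < N" "degree v' < N"
    by (simp_all add: N_def less_Suc_eq_le)
  then have "degree (u + u') < N" "degree (v + v') < N"
    by (simp_all add: degree_add_less)
  then show ?thesis
    unfolding fg elt_add using less by (simp add: act_extend[where N = N] smult_add_left sum.distrib)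
qed

lemma smult_right_sum: "smult (c :: 'l) (sum f I) = (\<Sum>i\<in>I. smult c (f i))"
  by (induction I rule: infinite_finite_induct) (simp_all add: smult_add_right)

lemma act_scale: "f \<in> AL \<Longrightarrow> act (k c * f) \<omega> = smult c (act f \<omega>)"
proof (elim AL_cases)
  fix u v assume f: "f = elt E u v"
  define N where "N = Suc (max (degree u) (degree v))"
  have "degree u < N" "degree v < N" "degree (smult c u) < N" "degree (smult c v) < N"
    using degree_smult_le[of c u] degree_smult_le[of c v] by (auto simp: N_def)
  moreover have "k c * f = elt E (smult c u) (smult c v)"
    by (simp add: f elt_conv algebra_simps)
  ultimately show ?thesis
    by (simp add: f act_extend[where N = N] smult_add_right smult_right_sum)
qed

lemma act_0: "act 0 \<omega> = 0"
  using act_scale[of 0 0 \<omega>] by simp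

lemma act_zero_right: "act g 0 = 0"
  by (simp add: motive_act_def tmul_def split: prod.splits)

lemma act_combination:
  assumes "finite I" "\<And>i. i \<in> I \<Longrightarrow> e i \<in> AL"
  shows "(\<Sum>i\<in>I. k (c i) * e i) \<in> AL \<and>
    act (\<Sum>i\<in>I. k (c i) * e i) \<omega> = (\<Sum>i\<in>I. smult (c i) (act (e i) \<omega>))"
  using assms by (induction I) (auto simp: act_0 act_add act_scale AL_intros)

text \<open>There are \<open>2 K\<close> functions \<open>x^i\<close> and \<open>x^i y\<close> with \<open>i < K\<close>, of pole order at most \<open>2 K + 1\<close>. Acting on three
  elements of degree at most \<open>D\<close> they give \<open>6 K\<close> elements of degree at most \<open>D + 4 K + 2\<close>, which are
  linearly dependent as soon as \<open>2 K > D + 3\<close>.\<close>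

lemma three_elements_dependent:
  fixes \<omega> :: "nat \<Rightarrow> 'l poly"
  shows "\<exists>g. (\<forall>s. g s \<in> AL) \<and> (\<exists>s<3. g s \<noteq> 0) \<and> (\<Sum>s<3. act (g s) (\<omega> s)) = 0"
proof -
  define D where "D = Max (degree ` \<omega> ` {..<3})"
  have D: "degree (\<omega> s) \<le> D" if "s < 3" for s using that by (auto simp: D_def)
  define K where "K = D + 4"
  define u where "u i = (if i < K then monom (1::'l) i else 0)" for i
  define v where "v i = (if i < K then 0 else monom (1::'l) (i - K))" for i
  define e where "e i = elt E (u i) (v i)" for i
  define I where "I = {..<3::nat} \<times> {..<2 * K}"
  (* a pair (s, i) stands for the function e i acting on the element \<omega> s *)
  have "\<exists>c. (\<exists>p\<in>I. c p \<noteq> 0) \<and> (\<Sum>p\<in>I. smult (c p) (act (e (snd p)) (\<omega> (fst p)))) = 0"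
  proof (rule polys_of_small_degree_dependent)
    show "card I > D + 4 * K + 3" by (simp add: I_def K_def)
    fix p j assume p: "p \<in> I" and j: "j \<ge> D + 4 * K + 3"
    have "e (snd p) \<noteq> 0" by (auto simp: e_def u_def v_def)
    have "pole_deg E (e (snd p)) \<le> 2 * K + 1"
      using p by (auto simp: e_def u_def v_def pole_deg_def degree_monom_eq I_def)
    moreover have "degree (\<omega> (fst p)) \<le> D" using p by (auto simp: I_def D)
    ultimately have "degree (act (e (snd p)) (\<omega> (fst p))) < j" if "\<omega> (fst p) \<noteq> 0"
      using act_degree[OF _ \<open>e (snd p) \<noteq> 0\<close> that] j by (simp add: e_def)
    then show "poly.coeff (act (e (snd p)) (\<omega> (fst p))) j = 0"
      by (cases "\<omega> (fst p) = 0") (auto simp: act_zero_right intro: coeff_eq_0)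
  qed (simp add: I_def)
  then obtain c where c: "\<exists>p\<in>I. c p \<noteq> 0"
    "(\<Sum>p\<in>I. smult (c p) (act (e (snd p)) (\<omega> (fst p)))) = 0" by blast
  define g where "g s = (\<Sum>i<2 * K. k (c (s, i)) * e i)" for s
  have comb: "g s \<in> AL \<and> act (g s) (\<omega> s) = (\<Sum>i<2 * K. smult (c (s, i)) (act (e i) (\<omega> s)))" for s
    unfolding g_def by (rule act_combination) (simp_all add: e_def)
  have "(\<Sum>s<3. act (g s) (\<omega> s)) = (\<Sum>p\<in>I. smult (c p) (act (e (snd p)) (\<omega> (fst p))))"
    by (simp add: comb I_def sum.cartesian_product split_def)
  moreover obtain s i where si: "s < 3" "i < 2 * K" "c (s, i) \<noteq> 0"
    using c(1) by (auto simp: I_def)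
  moreover have "g s \<noteq> 0"
  proof -
    have elt_sum: "(\<Sum>i\<in>J. k (d i) * elt E (u i) (v i))
        = elt E (\<Sum>i\<in>J. smult (d i) (u i)) (\<Sum>i\<in>J. smult (d i) (v i))" if "finite J" for J :: "nat set" and d
      using that by (induction J) (simp_all add: elt_conv algebra_simps)
    have g: "g s = elt E (\<Sum>i<2 * K. smult (c (s, i)) (u i)) (\<Sum>i<2 * K. smult (c (s, i)) (v i))"
      unfolding g_def e_def by (rule elt_sum) simp
    show ?thesis
    proof (cases "i < K")
      case True
      have "poly.coeff (\<Sum>j<2 * K. smult (c (s, j)) (u j)) i = (\<Sum>j<2 * K. if j = i then c (s, j) else 0)"
        unfolding coeff_sum using True by (intro sum.cong) (auto simp: u_def)
      then show ?thesis using si unfolding g by auto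
    next
      case False
      have "poly.coeff (\<Sum>j<2 * K. smult (c (s, j)) (v j)) (i - K)
          = (\<Sum>j<2 * K. if j = i then c (s, j) else 0)"
        unfolding coeff_sum using False by (intro sum.cong) (auto simp: v_def)
      then show ?thesis using si unfolding g by auto
    qed
  qed
  ultimately show ?thesis using comb c(2) by (intro exI[of _ g]) auto
qed

end

section \<open>The exterior square\<close>

lemma wedge_value_superset:
  assumes "finite S" "Poly_Mapping.keys F \<subseteq> S"
  shows "wedge_value w F = (\<Sum>p\<in>S. Poly_Mapping.lookup F p * w (fst p) (snd p))"
  unfolding wedge_value_def using assms
  by (intro sum.mono_neutral_left) (auto simp: in_keys_iff)

lemma wedge_value_diff: "wedge_value w (F - G) = wedge_value w F - wedge_value w G"
proof -
  let ?S = "Poly_Mapping.keys F \<union> Poly_Mapping.keys G"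
  have "Poly_Mapping.keys (F - G) \<subseteq> ?S"
    by (auto simp: in_keys_iff lookup_minus)
  then have "wedge_value w (F - G) = (\<Sum>p\<in>?S. Poly_Mapping.lookup (F - G) p * w (fst p) (snd p))"
    by (intro wedge_value_superset) auto
  also have "\<dots> = (\<Sum>p\<in>?S. Poly_Mapping.lookup F p * w (fst p) (snd p))
      - (\<Sum>p\<in>?S. Poly_Mapping.lookup G p * w (fst p) (snd p))"
    by (simp add: lookup_minus left_diff_distrib sum_subtractf)
  also have "\<dots> = wedge_value w F - wedge_value w G"
    using wedge_value_superset[of ?S F w] wedge_value_superset[of ?S G w] by simp
  finally show ?thesis .
qed

lemma wedge_value_single: "wedge_value w (Poly_Mapping.single (m, n) a) = a * w m n"
  by (simp add: wedge_value_def)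

context drinfeld_module
begin

context
  fixes D c w assumes wedge: "wedge_coordinate q E \<phi> D c w"
begin

lemma wedge_free_single: "a \<in> AL \<Longrightarrow> Poly_Mapping.single p a \<in> wedge_free E"
  by (simp add: wedge_free_def lookup_single when_def)

lemma wedge_free_diff: "F \<in> wedge_free E \<Longrightarrow> G \<in> wedge_free E \<Longrightarrow> F - G \<in> wedge_free E"
  by (simp add: wedge_free_def lookup_minus AL_diff)

lemma wedge_rel_value: "F \<in> wedge_rel q E \<phi> \<Longrightarrow> F \<in> wedge_free E \<Longrightarrow> wedge_value w F = 0"
  using wedge unfolding wedge_coordinate_def by blast

lemmas wedge_free_intros = wedge_free_diff wedge_free_single AL_1

lemma wedge_add_left: "w (m + m') n = w m n + w m' n"
  using wedge_rel_value[OF wedge_rel.add_left[of m m' n]]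
  by (simp add: wedge_free_intros wedge_value_diff wedge_value_single)
    (simp add: algebra_simps)

lemma wedge_add_right: "w m (n + n') = w m n + w m n'"
  using wedge_rel_value[OF wedge_rel.add_right[of m n n']]
  by (simp add: wedge_free_intros wedge_value_diff wedge_value_single)
    (simp add: algebra_simps)

lemma wedge_act_left: "a \<in> AL \<Longrightarrow> w (act a m) n = a * w m n"
  using wedge_rel_value[OF wedge_rel.act_left[of a E q \<phi> m n]]
  by (simp add: wedge_free_intros wedge_value_diff wedge_value_single)

lemma wedge_alternating: "w m m = 0"
  using wedge_rel_value[OF wedge_rel.alternating[of m q E \<phi>]]
  by (simp add: wedge_free_intros wedge_value_single)

lemma wedge_antisym: "w m n = - w n m"
  using wedge_alternating[of "m + n"] unfolding wedge_add_left wedge_add_right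
  by (simp add: wedge_alternating eq_neg_iff_add_eq_0 add.commute)

lemma wedge_diff_left: "w (m - m') n = w m n - w m' n"
  using wedge_add_left[of "m - m'" m' n] by simp

lemma wedge_mem: "w m n \<in> inv_ideal E D"
proof -
  have "wedge_value w (Poly_Mapping.single (m, n) 1) \<in> inv_ideal E D"
    using wedge unfolding wedge_coordinate_def by (auto simp: wedge_free_single)
  then show ?thesis by (simp add: wedge_value_single)
qed

lemma wedge_tau: "w (tau q m) (tau q n) = twist q E (w m n) * c"
  using wedge unfolding wedge_coordinate_def by blast

text \<open>There is a relation between \<open>z\<close>, \<open>a\<close> and \<open>b\<close>. Wedging it with \<open>a\<close> and with \<open>b\<close> shows that the
  coefficients at \<open>b\<close> and \<open>a\<close> vanish, so \<open>z\<close> would be a torsion element; the motive has none.\<close>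

lemma wedge_nondegenerate:
  assumes "w a b \<noteq> 0" "w z a = 0" "w z b = 0"
  shows "z = 0"
proof (rule ccontr)
  assume "z \<noteq> 0"
  define \<omega> where "\<omega> s = (if s = 0 then z else if s = 1 then a else b)" for s :: nat
  obtain g where AL: "\<And>s. g s \<in> AL" and g: "\<exists>s<3. g s \<noteq> 0" and "(\<Sum>s<3. act (g s) (\<omega> s)) = 0"
    using three_elements_dependent[of \<omega>] by blast
  then have dep: "act (g 0) z + act (g 1) a + act (g 2) b = 0"
    by (simp add: \<omega>_def eval_nat_numeral)
  have w0: "w 0 m = 0" for m
    using wedge_diff_left[of 0 0 m] by simp
  have "g 0 * w z m + g 1 * w a m + g 2 * w b m = 0" for m
    using arg_cong[OF dep, of "\<lambda>v. w v m"] AL by (simp add: wedge_add_left wedge_act_left w0)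
  from this[of a] this[of b] have "g 2 * w b a = 0" "g 1 * w a b = 0"
    using assms wedge_alternating by simp_all
  moreover have "w b a \<noteq> 0" using assms(1) wedge_antisym[of b a] by simp
  ultimately have "g 1 = 0" "g 2 = 0" using assms(1) by auto
  moreover from this have "act (g 0) z = 0" using dep by (simp add: act_0)
  then have "g 0 = 0" using act_degree[OF AL _ \<open>z \<noteq> 0\<close>] by blast
  ultimately have "g s = 0" if "s < 3" for s
    using that by (auto simp: eval_nat_numeral less_Suc_eq)
  with g show False by blast
qed

end

end

section \<open>The normalized relation\<close>

theorem corollary3p10:
  fixes E :: "('l::alg_closed_field, 'f::field) curve"
    and p n q :: nat
    and \<theta> \<eta> \<alpha> \<beta> m \<kappa> :: 'l
    and \<phi> :: "'f \<Rightarrow> 'l poly"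
    and w :: "'l poly \<Rightarrow> 'l poly \<Rightarrow> 'f"
    and h f\<^sub>\<alpha> :: 'f
    and V V' V'' :: "'l point"
  assumes "prime p" "CHAR('l) = p" "n > 0" "q = p ^ n"
    and "elliptic_over_Fq q E" "function_field E"
    and "generic_point q E \<theta> \<eta>"
    and "sgn_drinfeld_rank2 q E \<theta> \<eta> \<phi>"
    and "V = Affine \<alpha> \<beta>" "on_curve E V"
    and "add_pt E V (neg_pt E (frob_pt q V)) = Affine \<theta> \<eta>"
    and "m = (\<beta> ^ q - (- \<beta> - a\<^sub>1 E * \<alpha> - a\<^sub>3 E)) / (\<alpha> ^ q - \<alpha>)"
    and "f\<^sub>\<alpha> = (yf E - emb E \<eta> - emb E m * (xf E - emb E \<theta>)) / (xf E - emb E \<alpha>)"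
    \<comment> \<open>\<open>S\<^sub>0\<close> enters through \<open>w\<close>, with \<open>u \<wedge> v = w u v \<cdot> S\<^sub>0\<close>; then \<open>S\<^sub>0 = h s\<^sub>\<phi> \<wedge> \<tau> s\<^sub>\<phi>\<close>\<close>
    and "wedge_coordinate q E \<phi> (pt V) (- f\<^sub>\<alpha>) w"
    and "h * w s\<^sub>\<phi> (tau q s\<^sub>\<phi>) = 1" "sign E h = 1"
    and "on_curve E V'" "on_curve E V''"
    and "has_divisor E h (pt V + pt Infinity - pt V' - pt V'')"
    and "add_pt E V' V'' = V"
    and "line_slope E (neg_pt E V) V' V'' \<kappa>"
  shows "let
      x = xf E; y = yf E; k = emb E;
      \<beta>' = - \<beta> - a\<^sub>1 E * \<alpha> - a\<^sub>3 E;
      \<gamma>\<^sub>1 = (\<kappa> ^ q + m + a\<^sub>1 E) * (m - \<kappa>) - \<theta>;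
      \<gamma>\<^sub>2 = - (\<kappa> ^ q) - m - a\<^sub>1 E;
      \<chi>\<^sub>1 = \<kappa> ^ 2 + a\<^sub>1 E * \<kappa> - a\<^sub>2 E - \<alpha>;
      \<chi>\<^sub>2 = a\<^sub>4 E - 2 * \<kappa> * \<beta>' + \<kappa> ^ 2 * \<alpha> - a\<^sub>1 E * \<beta>' - a\<^sub>3 E * \<kappa> + a\<^sub>2 E * \<alpha> + \<alpha> ^ 2;
      C1' = y + k (\<kappa> + a\<^sub>1 E) * (x - k \<alpha>) - k \<beta>;
      claims = (\<lambda>C2 C1 C0.
        C2 = x ^ 2 - k \<chi>\<^sub>1 * x + k \<chi>\<^sub>2 \<and>
        (C1' = h * C2 \<and> (\<exists>l\<^sub>1 l\<^sub>2. C1 = k l\<^sub>2 * C2 + k l\<^sub>1 * C1')) \<and>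
        C0 = (x + k \<gamma>\<^sub>1) * C1' + k \<gamma>\<^sub>2 * C2)
    in (\<forall>C2 C1 C0. the_normalized_relation q E \<phi> C2 C1 C0 \<longrightarrow> claims C2 C1 C0) \<and>
       (\<exists>C2 C1 C0. normalized_relation q E \<phi> C2 C1 C0 \<and> claims C2 C1 C0)"
proof -
  have "q > 1"
    using one_less_power[of p n] prime_gt_1_nat[of p] assms(1,3,4) by simp
  interpret drinfeld_module E q \<phi> \<theta> \<eta>
  proof unfold_locales
    show "(c + d) ^ q = c ^ q + d ^ q" for c d :: 'l
      using assms(1,2,4) by (intro freshmans_dream') auto
  qed (use assms \<open>q > 1\<close> in \<open>auto simp: elliptic_over_Fq_def\<close>)
  note wedge = \<open>wedge_coordinate q E \<phi> (pt V) (- f\<^sub>\<alpha>) w\<close>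
  define \<beta>' where "\<beta>' = - \<beta> - a\<^sub>1 E * \<alpha> - a\<^sub>3 E"
  define \<gamma>\<^sub>1 where "\<gamma>\<^sub>1 = (\<kappa> ^ q + m + a\<^sub>1 E) * (m - \<kappa>) - \<theta>"
  define \<gamma>\<^sub>2 where "\<gamma>\<^sub>2 = - (\<kappa> ^ q) - m - a\<^sub>1 E"
  define \<chi>\<^sub>1 where "\<chi>\<^sub>1 = \<kappa> ^ 2 + a\<^sub>1 E * \<kappa> - a\<^sub>2 E - \<alpha>"
  define \<chi>\<^sub>2 where "\<chi>\<^sub>2 = a\<^sub>4 E - 2 * \<kappa> * \<beta>' + \<kappa> ^ 2 * \<alpha> - a\<^sub>1 E * \<beta>' - a\<^sub>3 E * \<kappa> + a\<^sub>2 E * \<alpha> + \<alpha> ^ 2"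
  define \<tau> where "\<tau> = tau q (1 :: 'l poly)"
  define \<tau>\<tau> where "\<tau>\<tau> = tau q \<tau>"
  define C1' where "C1' = y + k (\<kappa> + a\<^sub>1 E) * (x - k \<alpha>) - k \<beta>"
  define C2 where "C2 = x ^ 2 - k \<chi>\<^sub>1 * x + k \<chi>\<^sub>2"
  define C0 where "C0 = (x + k \<gamma>\<^sub>1) * C1' + k \<gamma>\<^sub>2 * C2"
  define l where "l = y - k \<beta>' - k \<kappa> * (x - k \<alpha>)"
  have V: "on_curve E (Affine \<alpha> \<beta>)" using assms(9,10) by simp
  have elts: "C1' = elt E [:- (\<kappa> + a\<^sub>1 E) * \<alpha> - \<beta>, \<kappa> + a\<^sub>1 E:] 1" "C2 = elt E [:\<chi>\<^sub>2, - \<chi>\<^sub>1, 1:] 0"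
    "l = elt E [:\<kappa> * \<alpha> - \<beta>', - \<kappa>:] 1" "x - k \<alpha> = elt E [:- \<alpha>, 1:] 0"
    by (simp_all add: elt_conv C1'_def C2_def l_def algebra_simps power2_eq_square)
  have elts_AL: "C1' \<in> AL" "C2 \<in> AL" "l \<in> AL" "x - k \<alpha> \<in> AL"
    by (simp_all only: elts AL_elt)
  have "C0 \<in> AL" unfolding C0_def by (intro AL_intros elts_AL)
  note AL = elts_AL(1,2) this elts_AL(3,4)
  have nz: "C1' \<noteq> 0" "C2 \<noteq> 0" "l \<noteq> 0" "x - k \<alpha> \<noteq> 0"
    by (simp_all only: elts elt_eq_0_iff) auto

  have hl: "h * l = x - k \<alpha>"
    using h_times_line[OF V] assms(9,16,19,21) unfolding l_def \<beta>'_def by blast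
  have lC1': "l * C1' = (x - k \<alpha>) * C2"
    unfolding l_def C1'_def C2_def \<chi>\<^sub>1_def \<chi>\<^sub>2_def by (rule line_product[OF V \<beta>'_def])
  have hC2: "C1' = h * C2"
  proof -
    have "l * C1' = l * (h * C2)" unfolding lC1' hl[symmetric] by simp
    then show ?thesis using nz(3) by simp
  qed
  have "h \<noteq> 0" using hl nz(4) by auto
  have w1\<tau>: "w 1 \<tau> = l / (x - k \<alpha>)"
    using assms(15) \<open>h \<noteq> 0\<close> nz(3) unfolding \<tau>_def hl[symmetric] by (simp add: field_simps)

  \<comment> \<open>If \<open>\<alpha>\<close> were fixed by the Frobenius, the quotient that defines \<open>m\<close> would be zero by convention and
    not a slope.\<close>
  have ne: "\<alpha> ^ q \<noteq> \<alpha>"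
    using frob_moves_point[OF V] assms(7,9,11) by blast
  have m: "m = (\<beta> ^ q - \<beta>') / (\<alpha> ^ q - \<alpha>)"
    using assms(12) unfolding \<beta>'_def .
  have \<theta>\<eta>: "\<theta> = m ^ 2 + a\<^sub>1 E * m - a\<^sub>2 E - \<alpha> - \<alpha> ^ q" "\<eta> - m * \<theta> = \<beta>' - m * \<alpha>"
    using generic_point_on_line[OF _ ne \<beta>'_def m] assms(9,11) by blast+
  \<comment> \<open>The numerator of \<open>f\<^sub>\<alpha>\<close>, written with the base point \<open>V\<^sup>\<or>\<close> of the line instead of \<open>\<xi>\<close>; \<open>lq\<close> is the twist of
    \<open>l\<close>.\<close>
  define L where "L = y - k \<beta>' - k m * (x - k \<alpha>)"
  have f\<^sub>\<alpha>: "f\<^sub>\<alpha> = L / (x - k \<alpha>)"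
  proof -
    have "k \<eta> - k m * k \<theta> = k \<beta>' - k m * k \<alpha>"
      using \<theta>\<eta>(2) by (metis emb_diff emb_mult)
    then show ?thesis unfolding assms(13) L_def by (simp add: algebra_simps)
  qed
  define lq where "lq = y - k (\<beta>' ^ q) - k (\<kappa> ^ q) * (x - k (\<alpha> ^ q))"
  have twisted: "L * lq = (x - k (\<alpha> ^ q)) * ((x + k \<gamma>\<^sub>1) * (x - k \<alpha>) + k \<gamma>\<^sub>2 * l)"
    unfolding L_def lq_def \<gamma>\<^sub>1_def \<gamma>\<^sub>2_def l_def
  proof (rule twisted_line_product[OF V \<beta>'_def on_curve_frob[OF V]])
    show "\<beta>' ^ q = - (\<beta> ^ q) - a\<^sub>1 E * \<alpha> ^ q - a\<^sub>3 E" unfolding \<beta>'_def by (simp add: frob_simps)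
    show "m * (\<alpha> ^ q - \<alpha>) = \<beta> ^ q - \<beta>'" using ne by (simp add: m)
  qed (rule ne \<theta>\<eta>(1))+

  have w\<tau>\<tau>: "w \<tau> \<tau>\<tau> = - (f\<^sub>\<alpha> * lq / (x - k (\<alpha> ^ q)))"
  proof -
    have "w \<tau> \<tau>\<tau> = twist q E (l / (x - k \<alpha>)) * (- f\<^sub>\<alpha>)"
      using wedge_tau[OF wedge, of 1 \<tau>] unfolding \<tau>\<tau>_def w1\<tau>[symmetric] by (simp add: \<tau>_def)
    also have "twist q E (l / (x - k \<alpha>)) = lq / (x - k (\<alpha> ^ q))"
      unfolding twist_fraction[OF AL(4,5) nz(4)] twist_ring_x_minus
      unfolding l_def twist_ring_line lq_def ..
    finally show ?thesis by simp
  qed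
  \<comment> \<open>The relation to be proved, wedged with \<open>\<tau> s\<^sub>\<phi>\<close>; it holds by the choice of \<open>\<gamma>\<^sub>1\<close> and \<open>\<gamma>\<^sub>2\<close>.\<close>
  have C0_eq: "C2 * w \<tau>\<tau> \<tau> = C0 * w 1 \<tau>"
  proof -
    have "C0 * l = (x + k \<gamma>\<^sub>1) * (l * C1') + k \<gamma>\<^sub>2 * C2 * l"
      unfolding C0_def by (simp add: algebra_simps)
    also have "\<dots> = C2 * ((x + k \<gamma>\<^sub>1) * (x - k \<alpha>) + k \<gamma>\<^sub>2 * l)"
      unfolding lC1' by (simp add: algebra_simps)
    finally have "C0 * l * (x - k (\<alpha> ^ q)) = C2 * (L * lq)"
      unfolding twisted by simp
    then show ?thesis
      using wedge_antisym[OF wedge, of \<tau>\<tau> \<tau>] x_minus_nz[of \<alpha>] x_minus_nz[of "\<alpha> ^ q"]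
      unfolding w\<tau>\<tau> w1\<tau> f\<^sub>\<alpha> by (simp add: frac_eq_eq mult_ac del: right_minus_eq)
  qed

  \<comment> \<open>Wedged with \<open>s\<^sub>\<phi>\<close>, the relation demands \<open>C1 = C1' r / (x - \<alpha>)\<close>. That this lies in \<open>A_L\<close> is known only
    after \<open>r\<close> is determined, so first the multiple of the relation by \<open>x - \<alpha>\<close> is proved.\<close>
  define v where "v = act C2 \<tau>\<tau> - act C0 1"
  define r where "r = (x - k \<alpha>) * w 1 \<tau>\<tau>"
  have r: "r \<in> AL" "eval_at E \<alpha> \<beta>' r = 0"
    using inv_ideal_clear[OF V, of "w 1 \<tau>\<tau>"] wedge_mem[OF wedge, of 1 \<tau>\<tau>] assms(9)
    unfolding r_def \<beta>'_def by auto
  have wv: "w v \<tau> = 0" "w v 1 = - C2 * w 1 \<tau>\<tau>"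
    using C0_eq wedge_antisym[OF wedge, of \<tau>\<tau> 1]
    by (simp_all add: v_def wedge_diff_left[OF wedge] wedge_act_left[OF wedge] AL wedge_alternating[OF wedge])
  have w_ne: "w 1 \<tau> \<noteq> 0" using w1\<tau> nz by simp
  have cleared: "act (x - k \<alpha>) v = act (C1' * r) \<tau>"
  proof -
    have "w (act (x - k \<alpha>) v - act (C1' * r) \<tau>) 1 = 0"
    proof -
      have "C1' * r * w 1 \<tau> = C1' * l * w 1 \<tau>\<tau>"
        unfolding w1\<tau> r_def using nz(4) by simp
      also have "\<dots> = (x - k \<alpha>) * C2 * w 1 \<tau>\<tau>"
        using lC1' by (simp add: mult.commute)
      finally show ?thesis
        using wedge_antisym[OF wedge, of \<tau> 1] r
        by (simp add: wedge_diff_left[OF wedge] wedge_act_left[OF wedge] AL AL_mult wv)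
    qed
    moreover have "w (act (x - k \<alpha>) v - act (C1' * r) \<tau>) \<tau> = 0"
      using r by (simp add: wedge_diff_left[OF wedge] wedge_act_left[OF wedge] AL AL_mult wv
          wedge_alternating[OF wedge])
    ultimately have "act (x - k \<alpha>) v - act (C1' * r) \<tau> = 0"
      by (rule wedge_nondegenerate[OF wedge w_ne])
    then show ?thesis by simp
  qed

  \<comment> \<open>The degrees in \<open>\<tau>\<close> of the two sides of \<open>cleared\<close> are at most \<open>14\<close> and equal to \<open>7 + 2 d\<close>, where \<open>d\<close> is
    the pole order of \<open>r\<close>.\<close>
  have \<tau>: "\<tau> \<noteq> 0" "degree \<tau> = 1" "\<tau>\<tau> \<noteq> 0" "degree \<tau>\<tau> = 2"
    using tmul_degree[of "monom 1 1" "1 :: 'l poly" q] tmul_degree[of "monom 1 1" \<tau> q]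
    unfolding \<tau>\<tau>_def \<tau>_def tau_def by (auto simp: degree_monom_eq)
  have C0_elt: "C0 = elt E ([:\<gamma>\<^sub>1, 1:] * [:- (\<kappa> + a\<^sub>1 E) * \<alpha> - \<beta>, \<kappa> + a\<^sub>1 E:]
      + smult \<gamma>\<^sub>2 [:\<chi>\<^sub>2, - \<chi>\<^sub>1, 1:]) [:\<gamma>\<^sub>1, 1:]"
    unfolding C0_def elts by (simp add: elt_conv algebra_simps)
  have deg_C: "pole_deg E C1' = 3" "pole_deg E C2 = 4" "pole_deg E C0 \<le> 5" "pole_deg E (x - k \<alpha>) = 2"
  proof -
    show "pole_deg E C1' = 3" "pole_deg E C2 = 4" "pole_deg E (x - k \<alpha>) = 2"
      unfolding elts by (simp_all add: pole_deg_def)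
    have "degree ([:\<gamma>\<^sub>1, 1:] * [:- (\<kappa> + a\<^sub>1 E) * \<alpha> - \<beta>, \<kappa> + a\<^sub>1 E:] + smult \<gamma>\<^sub>2 [:\<chi>\<^sub>2, - \<chi>\<^sub>1, 1:]) \<le> 2"
      by (intro degree_add_le order_trans[OF degree_mult_le] order_trans[OF degree_smult_le])
        (simp_all)
    then show "pole_deg E C0 \<le> 5" unfolding C0_elt by (simp add: pole_deg_def)
  qed
  have "degree v \<le> 10"
  proof -
    have "degree (act C2 \<tau>\<tau>) \<le> 10"
      using act_degree[OF AL(2) nz(2) \<tau>(3)] \<tau> deg_C by simp
    moreover have "degree (act C0 1) \<le> 10"
      using act_degree[OF AL(3), of 1] deg_C by (cases "C0 = 0") (auto simp: act_0)
    ultimately show ?thesis unfolding v_def by (rule degree_diff_le)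
  qed
  have deg_r: "pole_deg E r \<le> 3" if "r \<noteq> 0"
  proof -
    have "C1' * r \<noteq> 0" "C1' * r \<in> AL" using that nz r AL by (simp_all add: AL_mult)
    then have act: "act (C1' * r) \<tau> \<noteq> 0" "degree (act (C1' * r) \<tau>) = 1 + 2 * (3 + pole_deg E r)"
      using act_degree[of "C1' * r" \<tau>] \<tau> that nz r AL by (auto simp: pole_deg_mult deg_C)
    then have "v \<noteq> 0" using cleared act_zero_right by auto
    then have "degree (act (x - k \<alpha>) v) = degree v + 4"
      using act_degree[OF AL(5) nz(4)] deg_C by simp
    then show ?thesis using act(2) cleared \<open>degree v \<le> 10\<close> by simp
  qed
  obtain l\<^sub>2 l\<^sub>1 where r_eq: "r = k l\<^sub>2 * l + k l\<^sub>1 * (x - k \<alpha>)"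
  proof -
    obtain u u' where u: "r = elt E u u'" using r(1) by (elim AL_cases)
    have deg: "degree u' = 0" "degree u \<le> 1"
      using deg_r u by (cases "r = 0"; auto simp: pole_deg_def split: if_splits)+
    obtain b0 where u': "u' = [:b0:]" using deg(1) by (rule degree_eq_zeroE)
    obtain a0 a1 where u0: "u = [:a0, a1:]"
    proof
      show "u = [:poly.coeff u 0, poly.coeff u 1:]"
        using deg(2) by (intro poly_eqI) (auto simp: coeff_pCons coeff_eq_0 split: nat.splits)
    qed
    have a0: "a0 = - a1 * \<alpha> - b0 * \<beta>'"
      using r(2) unfolding u u0 u' by (simp add: algebra_simps eq_neg_iff_add_eq_0)
    have "r = k b0 * l + k (a1 + b0 * \<kappa>) * (x - k \<alpha>)"
      unfolding u u0 u' a0 l_def by (simp add: elt_conv algebra_simps)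
    then show ?thesis using that by blast
  qed
  define C1 where "C1 = k l\<^sub>2 * C2 + k l\<^sub>1 * C1'"
  have C1: "C1 \<in> AL" unfolding C1_def by (intro AL_intros AL)
  have C1_r: "(x - k \<alpha>) * C1 = C1' * r"
  proof -
    have "(x - k \<alpha>) * C1 = k l\<^sub>2 * ((x - k \<alpha>) * C2) + k l\<^sub>1 * (x - k \<alpha>) * C1'"
      unfolding C1_def by (simp add: algebra_simps)
    also have "\<dots> = C1' * r"
      unfolding lC1'[symmetric] r_eq by (simp add: algebra_simps)
    finally show ?thesis .
  qed
  have "act C2 \<tau>\<tau> - act C0 1 - act C1 \<tau> = 0"
  proof (rule wedge_nondegenerate[OF wedge w_ne])
    have "(x - k \<alpha>) * (C1 * w 1 \<tau>) = C1' * r * w 1 \<tau>"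
      using C1_r by (simp add: mult.assoc)
    also have "\<dots> = C1' * l * w 1 \<tau>\<tau>"
      unfolding w1\<tau> r_def using nz(4) by simp
    also have "\<dots> = (x - k \<alpha>) * (C2 * w 1 \<tau>\<tau>)"
      using lC1' by (simp add: mult_ac)
    finally have "C1 * w 1 \<tau> = C2 * w 1 \<tau>\<tau>" using nz(4) by simp
    then show "w (act C2 \<tau>\<tau> - act C0 1 - act C1 \<tau>) 1 = 0"
      using wv(2) wedge_antisym[OF wedge, of \<tau> 1] C1
      unfolding v_def[symmetric] by (simp add: wedge_diff_left[OF wedge] wedge_act_left[OF wedge])
    show "w (act C2 \<tau>\<tau> - act C0 1 - act C1 \<tau>) \<tau> = 0"
      using wv(1) C1 unfolding v_def[symmetric]
      by (simp add: wedge_diff_left[OF wedge] wedge_act_left[OF wedge] wedge_alternating[OF wedge])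
  qed
  then have relation: "act C2 \<tau>\<tau> = act C1 \<tau> + act C0 1" by (simp add: algebra_simps)

  have shape2: "\<exists>c1 c0. C2 = x ^ 2 + k c1 * x + k c0"
    unfolding C2_def by (intro exI[of _ "- \<chi>\<^sub>1"] exI[of _ \<chi>\<^sub>2]) simp
  have shape1: "\<exists>d3 d2 d1 d0. C1 = k d3 * x ^ 2 + k d2 * y + k d1 * x + k d0"
    unfolding C1_def C2_def C1'_def
    by (intro exI[of _ l\<^sub>2] exI[of _ l\<^sub>1] exI[of _ "l\<^sub>1 * (\<kappa> + a\<^sub>1 E) - l\<^sub>2 * \<chi>\<^sub>1"]
        exI[of _ "l\<^sub>2 * \<chi>\<^sub>2 - l\<^sub>1 * (\<kappa> + a\<^sub>1 E) * \<alpha> - l\<^sub>1 * \<beta>"]) (simp add: algebra_simps)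
  have shape0: "\<exists>e3 e2 e1 e0. C0 = x * y + k e3 * x ^ 2 + k e2 * y + k e1 * x + k e0"
    unfolding C0_def C2_def C1'_def
    by (intro exI[of _ "\<kappa> + a\<^sub>1 E + \<gamma>\<^sub>2"] exI[of _ \<gamma>\<^sub>1]
        exI[of _ "\<gamma>\<^sub>1 * (\<kappa> + a\<^sub>1 E) - (\<kappa> + a\<^sub>1 E) * \<alpha> - \<beta> - \<gamma>\<^sub>2 * \<chi>\<^sub>1"]
        exI[of _ "\<gamma>\<^sub>2 * \<chi>\<^sub>2 - \<gamma>\<^sub>1 * (\<kappa> + a\<^sub>1 E) * \<alpha> - \<gamma>\<^sub>1 * \<beta>"])
      (simp add: algebra_simps power2_eq_square)
  have normalized: "normalized_relation q E \<phi> C2 C1 C0"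
    unfolding normalized_relation_def Let_def
    using shape2 shape1 shape0 relation unfolding \<tau>_def \<tau>\<tau>_def by blast
  have claims: "C1' = h * C2 \<and> (\<exists>l\<^sub>1 l\<^sub>2. C1 = k l\<^sub>2 * C2 + k l\<^sub>1 * C1')"
    using hC2 C1_def by blast
  show ?thesis
    unfolding Let_def \<beta>'_def[symmetric]
    unfolding \<gamma>\<^sub>1_def[symmetric] \<gamma>\<^sub>2_def[symmetric] \<chi>\<^sub>1_def[symmetric] \<chi>\<^sub>2_def[symmetric]
    unfolding C1'_def[symmetric]
  proof (intro conjI allI impI)
    fix D2 D1 D0 assume "the_normalized_relation q E \<phi> D2 D1 D0"
    with normalized have D: "C2 = D2" "C1 = D1" "C0 = D0"
      unfolding the_normalized_relation_def by blast+
    show "D2 = x ^ 2 - k \<chi>\<^sub>1 * x + k \<chi>\<^sub>2" using C2_def D by simp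
    show "C1' = h * D2" "\<exists>l\<^sub>1 l\<^sub>2. D1 = k l\<^sub>2 * D2 + k l\<^sub>1 * C1'"
      using claims unfolding D by blast+
    show "D0 = (x + k \<gamma>\<^sub>1) * C1' + k \<gamma>\<^sub>2 * D2" using C0_def D by simp
  next
    show "\<exists>C2 C1 C0. normalized_relation q E \<phi> C2 C1 C0 \<and>
        C2 = x ^ 2 - k \<chi>\<^sub>1 * x + k \<chi>\<^sub>2 \<and>
        (C1' = h * C2 \<and> (\<exists>l\<^sub>1 l\<^sub>2. C1 = k l\<^sub>2 * C2 + k l\<^sub>1 * C1')) \<and>
        C0 = (x + k \<gamma>\<^sub>1) * C1' + k \<gamma>\<^sub>2 * C2"
      using normalized claims C2_def C0_def by blast
  qed
qed

end
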